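(* Let $q$ be a prime power with $q>9$ if $q$ is odd and $q>2$ if $q$ is even, and let $k>1$ be an integer. If $U$ is an intersecting family of more than $q^k-q^{k-1}$ polynomials over $\mathbb{F}_q$ of degree at most $k$, then there exist $\alpha,\beta\in\mathbb{F}_q$ such that $g(\alpha)=\beta$ for all $g\in U$. Furthermore, there is a unique intersecting family of exactly $q^k$ polynomials over $\mathbb{F}_q$ of degree at most $k$ containing $U$.
   Context: The graph of a function $f\colon\mathbb{F}_q\to\mathbb{F}_q$ is $U_f=\{(x,f(x)):x\in\mathbb{F}_q\}$. A set of polynomials over $\mathbb{F}_q$ is intersecting if the graphs of any two of its members share at least one point. *)

theory Defs
  imports "HOL-Computational_Algebra.Polynomial" "HOL-Library.Cardinality"
begin

definition intersecting :: "'a::comm_semiring_0 poly set \<Rightarrow> bool" where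
  "intersecting U \<longleftrightarrow> (\<forall>f\<in>U. \<forall>g\<in>U. \<exists>x. poly f x = poly g x)"

definition polys_deg_le :: "nat \<Rightarrow> 'a::zero poly set" where
  "polys_deg_le k = {p. degree p \<le> k}"

end

theory Submission
  imports Defs
begin

text \<open>
  The heart is the case \<open>k = 2\<close>. Let \<open>q\<close> be the order of the field, \<open>N = card U\<close>, and let
  \<open>e(x, y) + N/q\<close> be the number of members through \<open>(x, y)\<close>. Put \<open>z(h) = \<Sum>\<^sub>x e(x, h(x))\<close> for every
  polynomial \<open>h\<close> of degree at most \<open>2\<close> (a quadratic, for short). Up to a shift, \<open>z(h)\<close> counts
  the meeting points of \<open>h\<close> with the members of \<open>U\<close>, and almost every member that meets \<open>h\<close> does so twice.
  Hence \<open>z \<ge> A\<close> on \<open>U\<close> with \<open>A\<close> about \<open>q\<^sup>2\<close>, while a quadratic is missed by at most about half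
  of \<open>U\<close>, so that \<open>z \<ge> - B\<close> everywhere with \<open>B\<close> of order \<open>q\<close>. The values of a random quadratic at three
  distinct points are independent, so the second and third moments of \<open>z\<close> are, up to the factor \<open>q\<^sup>2\<close>,
  \<open>\<Sum> e\<^sup>2\<close> and \<open>\<Sum> e\<^sup>3 \<le> (max e) (\<Sum> e\<^sup>2)\<close>. Comparing them makes \<open>max e\<close> so large that more than
  half of the quadratics through one point lie in \<open>U\<close>, and then every member passes through this
  point. The field with four elements is too small for this and is treated by hand.

  For larger \<open>k\<close> one fixes the most frequent leading coefficient and applies induction to that slice.
\<close>

section \<open>Polynomials of bounded degree\<close>

lemma polys_deg_le_0: "polys_deg_le 0 = range (\<lambda>a. [:a:])"
  by (auto simp: polys_deg_le_def elim: degree_eq_zeroE)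

lemma polys_deg_le_Suc:
  "polys_deg_le (Suc k) = (\<lambda>(a, r). pCons a r) ` (UNIV \<times> polys_deg_le k)"
proof -
  have "p \<in> (\<lambda>(a, r). pCons a r) ` (UNIV \<times> polys_deg_le k)" if "degree p \<le> Suc k" for p :: "'a poly"
  proof -
    obtain a r where "p = pCons a r" by (cases p)
    with that show ?thesis by (force simp: polys_deg_le_def split: if_splits)
  qed
  then show ?thesis by (auto simp: polys_deg_le_def)
qed

lemma finite_polys_deg_le [simp]: "finite (polys_deg_le k :: 'a::{finite,zero} poly set)"
  by (induction k) (simp_all add: polys_deg_le_0 polys_deg_le_Suc)

lemma card_polys_deg_le: "card (polys_deg_le k :: 'a::{finite,zero} poly set) = CARD('a) ^ Suc k"
proof (induction k)
  case 0
  show ?case unfolding polys_deg_le_0 by (subst card_image) (auto intro: injI)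
next
  case (Suc k)
  have "inj_on (\<lambda>(a, r). pCons a r) (UNIV \<times> (polys_deg_le k :: 'a poly set))"
    by (auto simp: inj_on_def)
  then show ?case by (simp add: polys_deg_le_Suc card_image card_cartesian_product Suc)
qed

lemma polys_deg_le_closed:
  fixes p r :: "'a::comm_ring_1 poly"
  assumes "p \<in> polys_deg_le k" "r \<in> polys_deg_le k"
  shows "p + r \<in> polys_deg_le k" "p - r \<in> polys_deg_le k"
  using assms by (auto simp: polys_deg_le_def degree_add_le degree_diff_le)

lemma polys_deg_le_smult:
  fixes p :: "'a::comm_ring_1 poly"
  shows "p \<in> polys_deg_le k \<Longrightarrow> smult c p \<in> polys_deg_le k"
  using degree_smult_le[of c p] by (auto simp: polys_deg_le_def)

lemma polys_through_point:
  fixes \<alpha> \<beta> :: "'a::idom"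
  shows "{p \<in> polys_deg_le (Suc k). poly p \<alpha> = \<beta>} = (\<lambda>w. [:\<beta>:] + [:-\<alpha>, 1:] * w) ` polys_deg_le k"
proof (intro equalityI subsetI)
  fix p assume "p \<in> {p \<in> polys_deg_le (Suc k). poly p \<alpha> = \<beta>}"
  then have p: "degree p \<le> Suc k" "poly (p - [:\<beta>:]) \<alpha> = 0" by (auto simp: polys_deg_le_def)
  from p(2) obtain w where w: "p - [:\<beta>:] = [:-\<alpha>, 1:] * w"
    unfolding poly_eq_0_iff_dvd dvd_def by blast
  have "degree (p - [:\<beta>:]) \<le> Suc k" using p(1) by (intro degree_diff_le) auto
  then have "degree w \<le> k"
    unfolding w by (cases "w = 0") (simp_all add: degree_mult_eq del: mult_pCons_left)
  moreover have "p = [:\<beta>:] + [:-\<alpha>, 1:] * w" using w by (metis add.commute diff_add_cancel)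
  ultimately show "p \<in> (\<lambda>w. [:\<beta>:] + [:-\<alpha>, 1:] * w) ` polys_deg_le k"
    by (auto simp: polys_deg_le_def)
next
  fix p assume "p \<in> (\<lambda>w. [:\<beta>:] + [:-\<alpha>, 1:] * w) ` polys_deg_le k"
  then obtain w where w: "p = [:\<beta>:] + [:-\<alpha>, 1:] * w" "degree w \<le> k" by (auto simp: polys_deg_le_def)
  have "degree ([:-\<alpha>, 1:] * w) \<le> Suc k"
    using degree_mult_le[of "[:-\<alpha>, 1:]" w] w(2) by simp
  then show "p \<in> {p \<in> polys_deg_le (Suc k). poly p \<alpha> = \<beta>}"
    unfolding w(1) polys_deg_le_def
    by (simp del: mult_pCons_left add: degree_add_le)
qed

lemma card_polys_through_point:
  fixes \<alpha> \<beta> :: "'a::{finite,field}"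
  shows "card {p \<in> polys_deg_le (Suc k). poly p \<alpha> = \<beta>} = CARD('a) ^ Suc k"
proof -
  have "inj_on (\<lambda>w. [:\<beta>:] + [:-\<alpha>, 1:] * w) (polys_deg_le k)"
    by (rule inj_onI) (simp del: mult_pCons_left)
  then show ?thesis
    by (simp add: polys_through_point card_image card_polys_deg_le del: mult_pCons_left)
qed

lemma card_polys_through_two_points:
  fixes \<alpha> \<beta> :: "'a::{finite,field}"
  assumes "\<alpha> \<noteq> \<gamma>"
  shows "card {p \<in> polys_deg_le (Suc (Suc k)). poly p \<alpha> = \<beta> \<and> poly p \<gamma> = \<delta>} \<le> CARD('a) ^ Suc k"
proof -
  let ?g = "\<lambda>w. [:\<beta>:] + [:-\<alpha>, 1:] * w"
  let ?S = "{w \<in> polys_deg_le (Suc k). poly w \<gamma> = (\<delta> - \<beta>) / (\<gamma> - \<alpha>)}"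
  have "{p \<in> polys_deg_le (Suc (Suc k)). poly p \<alpha> = \<beta> \<and> poly p \<gamma> = \<delta>} \<subseteq> ?g ` ?S"
  proof
    fix p assume p: "p \<in> {p \<in> polys_deg_le (Suc (Suc k)). poly p \<alpha> = \<beta> \<and> poly p \<gamma> = \<delta>}"
    then have "p \<in> {p \<in> polys_deg_le (Suc (Suc k)). poly p \<alpha> = \<beta>}" by auto
    then obtain w where w: "p = ?g w" "w \<in> polys_deg_le (Suc k)"
      unfolding polys_through_point by blast
    have "\<beta> + (\<gamma> - \<alpha>) * poly w \<gamma> = \<delta>" using p w(1) by (simp add: algebra_simps)
    then have "poly w \<gamma> = (\<delta> - \<beta>) / (\<gamma> - \<alpha>)" using assms by (auto simp: field_simps)
    with w show "p \<in> ?g ` ?S" by blast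
  qed
  then have "card {p \<in> polys_deg_le (Suc (Suc k)). poly p \<alpha> = \<beta> \<and> poly p \<gamma> = \<delta>} \<le> card (?g ` ?S)"
    by (intro card_mono) auto
  also have "\<dots> \<le> card ?S" by (intro card_image_le) auto
  finally show ?thesis by (simp only: card_polys_through_point)
qed


lemma card_le_by_fibres:
  assumes "finite A" "f ` A \<subseteq> B" "finite B" "\<And>b. b \<in> B \<Longrightarrow> card {a\<in>A. f a = b} \<le> m"
  shows "card A \<le> card B * m"
proof -
  have "card A = (\<Sum>b\<in>B. card {a\<in>A. f a = b})"
    using sum.group[OF assms(1,3,2), of "\<lambda>_. 1::nat"] by simp
  also have "\<dots> \<le> (\<Sum>b\<in>B. m)" using assms by (intro sum_mono)
  finally show ?thesis by simp
qed

section \<open>Reduction to quadratics\<close>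

text \<open>The polynomials through \<open>(\<alpha>, \<beta>)\<close> are grouped into classes \<open>v + t (X - \<alpha>)\<close>. As \<open>F\<close> misses
  the common point, only the \<open>q - 1\<close> columns other than \<open>\<alpha>\<close> are left for meeting points, so in
  each class some member does not meet \<open>F\<close>.\<close>

lemma card_through_point_meeting_le:
  fixes V :: "'a::{finite,field} poly set" and F :: "'a \<Rightarrow> 'a"
  assumes V: "V \<subseteq> polys_deg_le (Suc (Suc k))" "\<forall>v\<in>V. poly v \<alpha> = \<beta>"
    and F: "F \<alpha> \<noteq> \<beta>" "\<forall>v\<in>V. \<exists>x. poly v x = F x"
  shows "card V \<le> CARD('a) ^ Suc k * (CARD('a) - 1)"
proof -
  \<comment> \<open>The cofactor of X - \<alpha> is split as \<open>pCons t w\<close>: w names the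
    class and t the place in it.\<close>
  let ?h = "\<lambda>(t, w). [:\<beta>:] + [:-\<alpha>, 1:] * pCons t w"
  define S where "S = {z. snd z \<in> polys_deg_le k \<and> ?h z \<in> V}"
  have finS: "finite S"
    by (rule finite_subset[of _ "UNIV \<times> polys_deg_le k"]) (auto simp: S_def)
  have "V \<subseteq> ?h ` S"
  proof
    fix v assume v: "v \<in> V"
    then have "v \<in> {p \<in> polys_deg_le (Suc (Suc k)). poly p \<alpha> = \<beta>}" using V by auto
    then obtain w where "v = [:\<beta>:] + [:-\<alpha>, 1:] * w" "w \<in> polys_deg_le (Suc k)"
      unfolding polys_through_point by blast
    then obtain t w' where "v = ?h (t, w')" "w' \<in> polys_deg_le k"
      unfolding polys_deg_le_Suc by force
    with v have "(t, w') \<in> S" "v = ?h (t, w')" by (simp_all only: S_def mem_Collect_eq snd_conv simp_thms)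
    then show "v \<in> ?h ` S" by blast
  qed
  then have "card V \<le> card S"
    using card_mono[OF finite_imageI[OF finS] \<open>V \<subseteq> ?h ` S\<close>] card_image_le[OF finS, of ?h] by linarith
  also have "card S \<le> card (polys_deg_le k :: 'a poly set) * (CARD('a) - 1)"
  proof (rule card_le_by_fibres[OF finS, of snd])
    fix w :: "'a poly"
    \<comment> \<open>For fixed w, a meeting with F in column x determines t, and \<open>g x\<close>
      is that value.\<close>
    define g where "g x = (F x - \<beta>) / (x - \<alpha>) - x * poly w x" for x
    have "fst z \<in> g ` (UNIV - {\<alpha>})" if z: "z \<in> S" "snd z = w" for z
    proof -
      have "\<exists>x. poly (?h z) x = F x" using F(2) z(1) unfolding S_def by blast
      then obtain x where x: "poly (?h z) x = F x" ..
      have 1: "\<beta> + (x - \<alpha>) * (fst z + x * poly w x) = F x"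
        using x z(2) by (simp add: case_prod_beta algebra_simps)
      with F(1) have ne: "x \<noteq> \<alpha>" by auto
      with 1 have "fst z = g x" unfolding g_def by (simp add: field_simps)
      with ne show ?thesis by blast
    qed
    then have "fst ` {z \<in> S. snd z = w} \<subseteq> g ` (UNIV - {\<alpha>})" by blast
    then have "card (fst ` {z \<in> S. snd z = w}) \<le> card (g ` (UNIV - {\<alpha>}))"
      by (intro card_mono) auto
    also have "\<dots> \<le> card (UNIV - {\<alpha>})" by (intro card_image_le) auto
    finally show "card {z \<in> S. snd z = w} \<le> CARD('a) - 1"
      by (subst (asm) card_image) (auto simp: inj_on_def)
  qed (auto simp: S_def)
  finally show ?thesis by (simp only: card_polys_deg_le)
qed

text \<open>Some coefficient of the top power occurs so often that its slice of U exceeds the bound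
  one degree lower. Subtracting the common top term keeps the slice intersecting and lowers the
  degree, so the induction hypothesis gives it a common point, which is then forced on the rest of
  U.\<close>

lemma common_point_from_quadratic:
  fixes U :: "'a::{finite,field} poly set"
  assumes base: "\<And>U :: 'a poly set. U \<subseteq> polys_deg_le 2 \<Longrightarrow> intersecting U \<Longrightarrow>
      card U > CARD('a) ^ 2 - CARD('a) \<Longrightarrow> \<exists>\<alpha> \<beta>. \<forall>g\<in>U. poly g \<alpha> = \<beta>"
  shows "U \<subseteq> polys_deg_le (Suc (Suc k)) \<Longrightarrow> intersecting U \<Longrightarrow>
      card U > CARD('a) ^ Suc (Suc k) - CARD('a) ^ Suc k \<Longrightarrow> \<exists>\<alpha> \<beta>. \<forall>g\<in>U. poly g \<alpha> = \<beta>"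
proof (induction k arbitrary: U)
  case 0
  then show ?case by (intro base) (simp_all add: numeral_2_eq_2)
next
  case (Suc k)
  let ?n = "Suc (Suc (Suc k))" and ?q = "CARD('a)"
  have finU: "finite U" by (rule finite_subset[OF Suc.prems(1)]) simp
  have "\<exists>c. card {g\<in>U. coeff g ?n = c} > ?q ^ Suc (Suc k) - ?q ^ Suc k"
  proof (rule ccontr)
    assume "\<not> ?thesis"
    then have "card {g\<in>U. coeff g ?n = c} \<le> ?q ^ Suc (Suc k) - ?q ^ Suc k" for c
      by (simp add: not_less)
    then have "card U \<le> CARD('a) * (?q ^ Suc (Suc k) - ?q ^ Suc k)"
      by (intro card_le_by_fibres[OF finU, of "\<lambda>g. coeff g ?n"]) auto
    with Suc.prems(3) show False by (simp add: algebra_simps)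
  qed
  then obtain c where c: "card {g\<in>U. coeff g ?n = c} > ?q ^ Suc (Suc k) - ?q ^ Suc k" ..
  define V where "V = (\<lambda>g. g - monom c ?n) ` {g\<in>U. coeff g ?n = c}"
  have cardV: "card V = card {g\<in>U. coeff g ?n = c}"
    unfolding V_def by (rule card_image) (auto simp: inj_on_def)
  have V: "V \<subseteq> polys_deg_le (Suc (Suc k))"
  proof
    fix v assume "v \<in> V"
    then obtain g where g: "g \<in> U" "coeff g ?n = c" "v = g - monom c ?n" by (auto simp: V_def)
    have "coeff v i = 0" if "i > Suc (Suc k)" for i
    proof (cases "i = ?n")
      case False
      then have "degree g < i" using that g(1) Suc.prems(1) by (force simp: polys_deg_le_def)
      then show ?thesis using g(3) False by (simp add: coeff_eq_0)
    qed (use g in simp)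
    then show "v \<in> polys_deg_le (Suc (Suc k))"
      by (auto simp: polys_deg_le_def intro: degree_le)
  qed
  have iV: "intersecting V"
    using Suc.prems(2) unfolding intersecting_def V_def by fastforce
  obtain \<alpha> \<beta> where ab: "\<forall>v\<in>V. poly v \<alpha> = \<beta>"
    using Suc.IH[OF V iV] c cardV by auto
  \<comment> \<open>For u outside the slice, u - c X^n still has degree n. This is why
    \<open>card_through_point_meeting_le\<close> admits an arbitrary function F.\<close>
  have "poly u \<alpha> = \<beta> + c * \<alpha> ^ ?n" if u: "u \<in> U" for u
  proof (rule ccontr)
    assume ne: "poly u \<alpha> \<noteq> \<beta> + c * \<alpha> ^ ?n"
    have "card V \<le> ?q ^ Suc k * (?q - 1)"
    proof (rule card_through_point_meeting_le[OF V ab])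
      show "poly u \<alpha> - c * \<alpha> ^ ?n \<noteq> \<beta>" using ne by (auto simp: algebra_simps)
      show "\<forall>v\<in>V. \<exists>x. poly v x = poly u x - c * x ^ ?n"
        using Suc.prems(2) u unfolding V_def intersecting_def by (fastforce simp: poly_monom)
    qed
    with c cardV show False by (simp add: algebra_simps)
  qed
  then show ?case by blast
qed

text \<open>All polynomials through the common point of U form one extension. Any extension is
  itself large, hence by \<open>st\<close> and its size it is the full set through some point. A
  different abscissa would confine U to the polynomials through two points, which are too few; with
  the same abscissa a member of U fixes the ordinate.\<close>

lemma unique_extension:
  fixes U :: "'a::{finite,field} poly set"
  assumes st: "\<And>U :: 'a poly set. U \<subseteq> polys_deg_le (Suc (Suc k)) \<Longrightarrow> intersecting U \<Longrightarrow>
      card U > CARD('a) ^ Suc (Suc k) - CARD('a) ^ Suc k \<Longrightarrow> \<exists>\<alpha> \<beta>. \<forall>g\<in>U. poly g \<alpha> = \<beta>"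
    and U: "U \<subseteq> polys_deg_le (Suc (Suc k))" "intersecting U"
      "card U > CARD('a) ^ Suc (Suc k) - CARD('a) ^ Suc k"
  shows "\<exists>!W. U \<subseteq> W \<and> W \<subseteq> polys_deg_le (Suc (Suc k)) \<and> intersecting W \<and> card W = CARD('a) ^ Suc (Suc k)"
proof -
  let ?q = "CARD('a)"
  let ?S = "\<lambda>\<alpha> \<beta>. {p \<in> polys_deg_le (Suc (Suc k)). poly p \<alpha> = \<beta>} :: 'a poly set"
  have q2: "?q \<ge> 2" using card_mono[of "UNIV :: 'a set" "{0, 1}"] by simp
  obtain \<alpha> \<beta> where ab: "\<forall>g\<in>U. poly g \<alpha> = \<beta>" using st[OF U] by blast
  show ?thesis
  proof (rule ex1I[of _ "?S \<alpha> \<beta>"])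
    show "U \<subseteq> ?S \<alpha> \<beta> \<and> ?S \<alpha> \<beta> \<subseteq> polys_deg_le (Suc (Suc k)) \<and> intersecting (?S \<alpha> \<beta>)
        \<and> card (?S \<alpha> \<beta>) = ?q ^ Suc (Suc k)"
      using U(1) ab by (auto simp: intersecting_def card_polys_through_point simp del: power_Suc intro!: exI[of _ \<alpha>])
  next
    fix W assume W: "U \<subseteq> W \<and> W \<subseteq> polys_deg_le (Suc (Suc k)) \<and> intersecting W \<and> card W = ?q ^ Suc (Suc k)"
    have "?q ^ Suc k > 0" using q2 by simp
    then have "card W > ?q ^ Suc (Suc k) - ?q ^ Suc k" using W q2 by simp
    then obtain \<gamma> \<delta> where cd: "\<forall>g\<in>W. poly g \<gamma> = \<delta>" using st W by blast
    then have "W \<subseteq> ?S \<gamma> \<delta>" using W by auto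
    then have Weq: "W = ?S \<gamma> \<delta>"
      using W by (intro card_subset_eq) (simp_all add: card_polys_through_point del: power_Suc)
    have "\<alpha> = \<gamma>"
    proof (rule ccontr)
      assume ne: "\<alpha> \<noteq> \<gamma>"
      have "U \<subseteq> {p \<in> polys_deg_le (Suc (Suc k)). poly p \<alpha> = \<beta> \<and> poly p \<gamma> = \<delta>}"
        using ab cd W U(1) by auto
      then have "card U \<le> card {p \<in> polys_deg_le (Suc (Suc k)). poly p \<alpha> = \<beta> \<and> poly p \<gamma> = \<delta>}"
        by (intro card_mono) auto
      also have "\<dots> \<le> ?q ^ Suc k" by (rule card_polys_through_two_points[OF ne])
      also have "2 * ?q ^ Suc k \<le> ?q ^ Suc (Suc k)" using q2 by simp
      ultimately show False using U(3) by linarith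
    qed
    moreover obtain u where "u \<in> U" using U(3) by (metis card.empty ex_in_conv not_less_zero)
    ultimately have "\<beta> = \<delta>" using ab cd W by auto
    with Weq \<open>\<alpha> = \<gamma>\<close> show "W = ?S \<alpha> \<beta>" by simp
  qed
qed

section \<open>Meeting numbers of intersecting quadratics\<close>

lemma polys_deg_le_2_cases:
  assumes "p \<in> polys_deg_le 2"
  obtains a b c where "p = [:a, b, c:]"
  using assms by (auto simp: numeral_2_eq_2 polys_deg_le_Suc polys_deg_le_0)

lemma quadratic_eqI:
  assumes "p \<in> polys_deg_le 2" "r \<in> polys_deg_le 2"
    "coeff p 0 = coeff r 0" "coeff p 1 = coeff r 1" "coeff p 2 = coeff r 2"
  shows "p = r"
proof -
  obtain a b c where p: "p = [:a, b, c:]" using assms(1) by (rule polys_deg_le_2_cases)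
  obtain a' b' c' where r: "r = [:a', b', c':]" using assms(2) by (rule polys_deg_le_2_cases)
  show ?thesis using assms(3-5) unfolding p r by (simp add: numeral_2_eq_2)
qed

lemma quadratic_taylor:
  fixes p :: "'a::comm_ring_1 poly"
  assumes "p \<in> polys_deg_le 2"
  shows "poly p z = poly p x + (coeff p 1 + 2 * coeff p 2 * x) * (z - x) + coeff p 2 * (z - x)\<^sup>2"
proof -
  obtain a b c where p: "p = [:a, b, c:]" using assms(1) by (rule polys_deg_le_2_cases)
  show ?thesis unfolding p by (simp add: numeral_2_eq_2 algebra_simps)
qed

text \<open>z^2 + \<mu> z takes equal values at 0 and -\<mu>, so for \<mu> \<noteq> 0 it omits a
  value d. Reversing the coefficients of z^2 + \<mu> z - d gives the rootless polynomial with c =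
  -d.\<close>

lemma rootless_multiple_one:
  fixes \<mu> :: "'a::{finite,field}"
  shows "\<exists>c. \<forall>z. c * z\<^sup>2 + \<mu> * z + 1 \<noteq> 0"
proof (cases "\<mu> = 0")
  case True
  then show ?thesis by (intro exI[of _ 0]) simp
next
  case False
  have "\<not> inj (\<lambda>z. z\<^sup>2 + \<mu> * z)"
  proof
    assume "inj (\<lambda>z. z\<^sup>2 + \<mu> * z)"
    from injD[OF this, of 0 "-\<mu>"] False show False by (simp add: power2_eq_square)
  qed
  then have "\<not> surj (\<lambda>z. z\<^sup>2 + \<mu> * z)" by (metis finite finite_UNIV_surj_inj)
  then obtain d where d: "\<And>z. z\<^sup>2 + \<mu> * z \<noteq> d" by (auto simp: surj_def eq_commute)
  have "- d * z\<^sup>2 + \<mu> * z + 1 \<noteq> 0" for z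
  proof
    assume *: "- d * z\<^sup>2 + \<mu> * z + 1 = 0"
    then have "z \<noteq> 0" by auto
    then have "(1 / z)\<^sup>2 + \<mu> * (1 / z) - d = (- d * z\<^sup>2 + \<mu> * z + 1) / z\<^sup>2"
      by (simp add: add_divide_distrib diff_divide_distrib power2_eq_square)
    then have "(1 / z)\<^sup>2 + \<mu> * (1 / z) = d" using * by simp
    with d show False by blast
  qed
  then show ?thesis by blast
qed

text \<open>Sending (r, s) to the coefficients of (X - r)(X - s) is at most two-to-one off the
  diagonal and injective on it, so at least (q^2 - q)/2 + q monic quadratics have a root.\<close>

lemma card_monic_rootless:
  "2 * card {(b, f). \<forall>x::'a::{finite,field}. x\<^sup>2 + b * x + f \<noteq> 0} + CARD('a) \<le> CARD('a)\<^sup>2"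
proof -
  let ?q = "CARD('a)"
  define \<phi> :: "'a \<times> 'a \<Rightarrow> 'a \<times> 'a" where "\<phi> = (\<lambda>(r, s). (- (r + s), r * s))"
  define R where "R = {(b, f). \<exists>x::'a. x\<^sup>2 + b * x + f = 0}"
  define \<Delta> where "\<Delta> = (\<lambda>r::'a. (r, r)) ` UNIV"
  have phi_eq: "z = (r, s) \<or> z = (s, r)" if "\<phi> z = \<phi> (r, s)" for z r s
  proof -
    obtain r' s' where z: "z = (r', s')" by fastforce
    have 1: "r' + s' = r + s" "r' * s' = r * s" using that unfolding \<phi>_def z
      by (simp_all only: prod.case prod.inject neg_equal_iff_equal)
    have "(r' - r) * (r' - s) = r' * r' - (r + s) * r' + r * s" by (simp add: algebra_simps)
    also have "\<dots> = 0" by (simp flip: 1 add: algebra_simps)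
    finally have "r' = r \<or> r' = s" by simp
    then show ?thesis using 1(1) z by auto
  qed
  have card\<Delta>: "card \<Delta> = ?q" unfolding \<Delta>_def by (subst card_image) (auto intro: injI)
  have inj\<Delta>: "inj_on \<phi> \<Delta>" by (rule inj_onI) (use phi_eq in \<open>force simp: \<Delta>_def\<close>)
  have "card (UNIV - \<Delta>) \<le> card (\<phi> ` (UNIV - \<Delta>)) * 2"
  proof (rule card_le_by_fibres[where f = \<phi>])
    fix y assume "y \<in> \<phi> ` (UNIV - \<Delta>)"
    then obtain r s where y: "y = \<phi> (r, s)" by fastforce
    then have "{a \<in> UNIV - \<Delta>. \<phi> a = y} \<subseteq> {(r, s), (s, r)}" using phi_eq by blast
    then have "card {a \<in> UNIV - \<Delta>. \<phi> a = y} \<le> card {(r, s), (s, r)}" by (intro card_mono) auto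
    also have "\<dots> \<le> 2" by (cases "r = s") auto
    finally show "card {a \<in> UNIV - \<Delta>. \<phi> a = y} \<le> 2" .
  qed auto
  moreover have "card (UNIV - \<Delta>) = ?q\<^sup>2 - ?q"
    using card_Diff_subset[of \<Delta> UNIV] by (simp add: card\<Delta> power2_eq_square)
  moreover have "?q \<le> ?q\<^sup>2" by (simp add: power2_eq_square)
  moreover have "card (\<phi> ` (UNIV - \<Delta>)) + ?q \<le> card R"
  proof -
    have "\<phi> ` (UNIV - \<Delta>) \<inter> \<phi> ` \<Delta> = {}"
    proof -
      have "False" if "z \<notin> \<Delta>" "w \<in> \<Delta>" "\<phi> z = \<phi> w" for z w
        using that phi_eq[of z] unfolding \<Delta>_def by blast
      then show ?thesis by blast
    qed
    then have "card (\<phi> ` (UNIV - \<Delta>)) + card (\<phi> ` \<Delta>) = card (\<phi> ` (UNIV - \<Delta>) \<union> \<phi> ` \<Delta>)"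
      by (subst card_Un_disjoint) auto
    also have "\<dots> \<le> card R"
    proof (rule card_mono)
      have "\<phi> z \<in> R" for z
        by (cases z) (auto simp: \<phi>_def R_def power2_eq_square algebra_simps intro!: exI[of _ "fst z"])
      then show "\<phi> ` (UNIV - \<Delta>) \<union> \<phi> ` \<Delta> \<subseteq> R" by blast
    qed simp
    finally show ?thesis by (simp add: card_image[OF inj\<Delta>] card\<Delta>)
  qed
  moreover have "card {(b, f). \<forall>x::'a. x\<^sup>2 + b * x + f \<noteq> 0} + card R = ?q\<^sup>2"
  proof -
    have "{(b, f). \<forall>x::'a. x\<^sup>2 + b * x + f \<noteq> 0} = UNIV - R" by (auto simp: R_def)
    moreover have "card (UNIV - R) + card R = CARD('a \<times> 'a)"
      using card_Diff_subset[of R UNIV] card_mono[of UNIV R] by simp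
    ultimately show ?thesis by (simp add: power2_eq_square)
  qed
  ultimately show ?thesis by linarith
qed

lemma card_le_CARD_by_inj:
  fixes f :: "'b \<Rightarrow> 'a::finite"
  assumes "inj_on f S"
  shows "card S \<le> CARD('a)"
  by (rule card_inj_on_le[OF assms]) auto

text \<open>The root x splits off from u - h and leaves a linear factor, whose root equals x only if
  u - h is a multiple of a square.\<close>

lemma two_meeting_points:
  fixes u h :: "'a::field poly"
  assumes uh: "u \<in> polys_deg_le 2" "h \<in> polys_deg_le 2"
    and x: "poly h x = poly u x" and c: "coeff u 2 \<noteq> coeff h 2"
    and dbl: "\<And>c r. u \<noteq> h + smult c ([:-r, 1:]\<^sup>2)"
  shows "\<exists>y. y \<noteq> x \<and> poly h y = poly u y"
proof -
  have "u - h \<in> polys_deg_le (Suc 1)" using polys_deg_le_closed(2)[OF uh] by (simp add: numeral_2_eq_2)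
  then have "u - h \<in> {p \<in> polys_deg_le (Suc 1). poly p x = 0}" using x by simp
  then obtain w where w: "u - h = [:0:] + [:-x, 1:] * w" "w \<in> polys_deg_le 1"
    unfolding polys_through_point by blast
  from w(2) obtain d e where de: "w = [:d, e:]"
    by (auto simp: polys_deg_le_Suc polys_deg_le_0)
  have e: "e \<noteq> 0"
  proof
    assume "e = 0"
    then have "coeff (u - h) 2 = 0" using w(1) de by (simp add: numeral_2_eq_2)
    with c show False by simp
  qed
  have "- d / e \<noteq> x"
  proof
    assume "- d / e = x"
    then have "- d = x * e" using e by (simp add: field_simps)
    then have "d = - x * e" by (metis minus_minus mult_minus_left)
    then have "w = smult e [:-x, 1:]" using de by simp
    then have "u - h = smult e ([:-x, 1:]\<^sup>2)"
      using w(1) by (simp add: power2_eq_square)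
    then have "u = h + smult e ([:-x, 1:]\<^sup>2)" by (metis add.commute diff_add_cancel)
    with dbl show False by blast
  qed
  moreover have "poly (u - h) (- d / e) = 0"
    using w(1) de e by simp
  ultimately show ?thesis by (intro exI[of _ "- d / e"]) auto
qed

section \<open>Meeting counts inside an intersecting family\<close>

locale intersecting_quadratics =
  fixes U :: "'a::{finite,field} poly set"
  assumes quad: "U \<subseteq> polys_deg_le 2" and inter: "intersecting U"
begin

definition meet :: "'a poly \<Rightarrow> 'a poly \<Rightarrow> 'a set" where
  "meet h u = {x. poly h x = poly u x}"

definition through :: "'a \<Rightarrow> 'a \<Rightarrow> 'a poly set" where
  "through x y = {u \<in> U. poly u x = y}"

definition miss :: "'a poly \<Rightarrow> 'a poly set" where
  "miss h = {u \<in> U. meet h u = {}}"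

text \<open>\<open>lin\<close> and \<open>dbl\<close> hold the members that may meet h in a single
  point: u - h has no quadratic term, or is a multiple of a square.\<close>

definition lin :: "'a poly \<Rightarrow> 'a poly set" where
  "lin h = {u \<in> U. u \<noteq> h \<and> coeff u 2 = coeff h 2}"

definition dbl :: "'a poly \<Rightarrow> 'a poly set" where
  "dbl h = {u \<in> U. u \<noteq> h \<and> (\<exists>c r. u = h + smult c ([:-r, 1:]\<^sup>2))}"

text \<open>Here c = 0 is allowed: if h is in U, it belongs to \<open>tangent x h\<close> for every
  x, although never to \<open>dbl h\<close>.\<close>

definition tangent :: "'a \<Rightarrow> 'a poly \<Rightarrow> 'a poly set" where
  "tangent x h = {u \<in> U. \<exists>c. u = h + smult c ([:-x, 1:]\<^sup>2)}"

text \<open>This counts the pairs of a member u and a column where u meets h; subtracting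
  \<open>card U\<close> gives z(h).\<close>

definition weight :: "'a poly \<Rightarrow> nat" where
  "weight h = (\<Sum>x\<in>UNIV. card (through x (poly h x)))"

lemma finU [simp]: "finite U"
  using quad by (rule finite_subset) simp

lemma fin_sub [simp]: "finite (through x y)" "finite (miss h)" "finite (lin h)" "finite (dbl h)"
    "finite (tangent x h)" "finite (meet h u)"
  by (simp_all add: through_def miss_def lin_def dbl_def tangent_def)

lemma quadD: "u \<in> U \<Longrightarrow> u \<in> polys_deg_le 2"
  using quad by blast

text \<open>Evaluate at a common point of u and v. Several bounds below come from this: members that
  differ by a multiple of a rootless function are equal, so projecting along a rootless direction is
  injective.\<close>

lemma rootless_diff:
  assumes "u \<in> U" "v \<in> U" "\<And>x. poly u x - poly v x = t * g x" "\<And>x. g x \<noteq> 0"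
  shows "t = 0"
proof -
  obtain x where "poly u x = poly v x" using inter assms(1,2) by (auto simp: intersecting_def)
  with assms(3)[of x] assms(4)[of x] show ?thesis by simp
qed

lemma const_diff:
  assumes "u \<in> U" "v \<in> U" "coeff u 1 = coeff v 1" "coeff u 2 = coeff v 2"
  shows "u = v"
proof -
  have "poly u x - poly v x = (coeff u 0 - coeff v 0) * 1" for x
    using quadratic_taylor[OF quadD[OF assms(1)], of x 0]
      quadratic_taylor[OF quadD[OF assms(2)], of x 0] assms(3,4) by (simp add: poly_0_coeff_0)
  from rootless_diff[OF assms(1,2), where g = "\<lambda>_. 1", OF this] have "coeff u 0 - coeff v 0 = 0"
    by simp
  then have "coeff u 0 = coeff v 0" by simp
  then show ?thesis by (rule quadratic_eqI[OF quadD quadD, OF assms(1,2) _ assms(3,4)])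
qed

lemma card_coeff1_le: "card {u \<in> U. coeff u 1 = b} \<le> CARD('a)"
  by (rule card_le_CARD_by_inj[of "\<lambda>u. coeff u 2"]) (auto intro!: inj_onI const_diff)

lemma card_coeff2_le: "card {u \<in> U. coeff u 2 = c} \<le> CARD('a)"
  by (rule card_le_CARD_by_inj[of "\<lambda>u. coeff u 1"]) (auto intro!: inj_onI const_diff)

lemma card_lin_le: "card (lin h) + of_bool (h \<in> U) \<le> CARD('a)"
proof -
  have "lin h \<union> (if h \<in> U then {h} else {}) \<subseteq> {u \<in> U. coeff u 2 = coeff h 2}"
    by (auto simp: lin_def)
  from card_mono[OF _ this] card_coeff2_le[of "coeff h 2"]
  have "card (lin h \<union> (if h \<in> U then {h} else {})) \<le> CARD('a)" by simp
  moreover have "h \<notin> lin h" by (simp add: lin_def)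
  ultimately show ?thesis by (auto split: if_splits)
qed

lemma sum_card_meet:
  assumes "finite S"
  shows "(\<Sum>u\<in>S. card (meet h u)) = (\<Sum>x\<in>UNIV. card {u \<in> S. poly u x = poly h x})"
proof -
  have "card {u \<in> S. poly u x = poly h x} = (\<Sum>u\<in>S. of_bool (poly h x = poly u x))" for x
    using assms by (simp add: sum_of_bool_eq Int_def eq_commute[of "poly h x"])
  moreover have "card (meet h u) = (\<Sum>x\<in>UNIV. of_bool (poly h x = poly u x))" for u
    by (simp add: meet_def sum_of_bool_eq)
  ultimately show ?thesis
    by (simp only: sum.swap[of "\<lambda>x u. of_bool (poly h x = poly u x)" S UNIV])
qed

lemma meet_weight: "weight h = (\<Sum>u\<in>U. card (meet h u))"
  by (simp add: sum_card_meet weight_def through_def)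

text \<open>A member that meets h has a second meeting point unless it lies in \<open>lin h\<close>
  or \<open>dbl h\<close>, whose indicators make up for it.\<close>

lemma card_meet_ge:
  assumes "u \<in> U" "h \<in> polys_deg_le 2" "u \<noteq> h"
  shows "2 * of_bool (u \<notin> miss h) \<le> card (meet h u) + of_bool (u \<in> lin h) + of_bool (u \<in> dbl h)"
proof (cases "u \<in> miss h")
  case False
  then obtain x where x: "poly h x = poly u x" using assms(1) by (auto simp: miss_def meet_def)
  then have c1: "card (meet h u) \<ge> 1"
    by (auto simp: meet_def Suc_le_eq card_gt_0_iff)
  show ?thesis
  proof (cases "u \<in> lin h \<or> u \<in> dbl h")
    case False
    then have "coeff u 2 \<noteq> coeff h 2" "\<And>c r. u \<noteq> h + smult c ([:-r, 1:]\<^sup>2)"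
      using assms by (auto simp: lin_def dbl_def)
    from two_meeting_points[OF quadD[OF assms(1)] assms(2) x this]
    obtain y where "y \<noteq> x" "poly h y = poly u y" by blast
    then have "card {x, y} \<le> card (meet h u)" using x by (intro card_mono) (auto simp: meet_def)
    with \<open>y \<noteq> x\<close> show ?thesis by simp
  qed (use c1 in auto)
qed simp

lemma sum_meet_ge:
  assumes "S \<subseteq> U" "h \<in> polys_deg_le 2" "h \<notin> S"
  shows "2 * card (S - miss h) \<le> (\<Sum>u\<in>S. card (meet h u)) + card (S \<inter> lin h) + card (S \<inter> dbl h)"
proof -
  have finS: "finite S" using assms(1) by (rule finite_subset) simp
  have "(\<Sum>u\<in>S. 2 * of_bool (u \<notin> miss h)) \<le>
      (\<Sum>u\<in>S. card (meet h u) + of_bool (u \<in> lin h) + of_bool (u \<in> dbl h))"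
    using assms by (intro sum_mono card_meet_ge) auto
  then show ?thesis
    using finS by (simp add: sum.distrib sum_of_bool_eq set_diff_eq Int_def flip: sum_distrib_left)
qed

text \<open>A member misses no member. It meets itself in all q columns, and the constant 2 offsets
  its own share in \<open>2 * card U\<close>.\<close>

lemma weight_ge_member:
  assumes "h \<in> U"
  shows "weight h + card (lin h) + card (dbl h) + 2 \<ge> CARD('a) + 2 * card U"
proof -
  have "2 * card (U - {h} - miss h) \<le> (\<Sum>u\<in>U - {h}. card (meet h u)) + card ((U - {h}) \<inter> lin h) + card ((U - {h}) \<inter> dbl h)"
    by (rule sum_meet_ge) (use assms quadD in auto)
  moreover have "miss h = {}" using inter assms by (auto simp: miss_def meet_def intersecting_def)
  moreover have "card ((U - {h}) \<inter> lin h) \<le> card (lin h)" "card ((U - {h}) \<inter> dbl h) \<le> card (dbl h)"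
    by (auto intro: card_mono)
  moreover have "weight h = card (meet h h) + (\<Sum>u\<in>U - {h}. card (meet h u))"
    unfolding meet_weight by (rule sum.remove) (use assms in auto)
  moreover have "meet h h = UNIV" by (auto simp: meet_def)
  moreover have "card U = Suc (card (U - {h}))" by (rule card.remove) (use assms in simp_all)
  ultimately show ?thesis by simp
qed

lemma weight_ge_nonmember:
  assumes "h \<in> polys_deg_le 2" "h \<notin> U"
  shows "weight h + card (lin h) + card (dbl h) + 2 * card (miss h) \<ge> 2 * card U"
proof -
  have "2 * card (U - miss h) \<le> weight h + card (U \<inter> lin h) + card (U \<inter> dbl h)"
    unfolding meet_weight by (rule sum_meet_ge) (use assms in auto)
  moreover have "card (U \<inter> lin h) \<le> card (lin h)" "card (U \<inter> dbl h) \<le> card (dbl h)"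
    by (auto intro: card_mono)
  moreover have "card U = card (U - miss h) + card (miss h)"
    using card_Diff_subset[of "miss h" U] card_mono[of U "miss h"] by (auto simp: miss_def)
  ultimately show ?thesis by linarith
qed

text \<open>A rootless difference u - h is constant or has a non-zero X^2-coefficient. In the latter
  case its monic multiple determines u: equal normal forms make u - v a multiple of a rootless
  quadratic. The constant differences share the label \<open>None\<close> and come from at most one
  member, which accounts for the 2.\<close>

lemma card_miss_le:
  assumes h: "h \<in> polys_deg_le 2"
  shows "2 * card (miss h) + CARD('a) \<le> CARD('a)\<^sup>2 + 2"
proof -
  define R where "R = {(b, f). \<forall>x::'a. x\<^sup>2 + b * x + f \<noteq> 0}"
  define d where "d k u = coeff u k - coeff h k" for k u
  define \<nu> where "\<nu> u = (if d 2 u = 0 then None else Some (d 1 u / d 2 u, d 0 u / d 2 u))" for u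
  have val: "poly u x - poly h x = d 0 u + d 1 u * x + d 2 u * x\<^sup>2"
    if "u \<in> miss h" for u x
    using quadratic_taylor[OF polys_deg_le_closed(2)[OF quadD h], of u x 0] that
    by (simp add: miss_def poly_0_coeff_0 d_def)
  have ne: "poly u x - poly h x \<noteq> 0" if "u \<in> miss h" for u x
    using that unfolding miss_def meet_def by (metis (mono_tags, lifting) eq_iff_diff_eq_0 empty_Collect_eq mem_Collect_eq)
  have lin0: "d 1 u = 0" if "u \<in> miss h" "d 2 u = 0" for u
  proof (rule ccontr)
    assume "d 1 u \<noteq> 0"
    then have "poly u (- d 0 u / d 1 u) - poly h (- d 0 u / d 1 u) = 0"
      using val[OF that(1)] that(2) by simp
    with ne[OF that(1)] show False by blast
  qed
  have "inj_on \<nu> (miss h)"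
  proof (rule inj_onI)
    fix u v assume uv: "u \<in> miss h" "v \<in> miss h" "\<nu> u = \<nu> v"
    then have U: "u \<in> U" "v \<in> U" by (auto simp: miss_def)
    have z: "d 2 u = 0 \<longleftrightarrow> d 2 v = 0"
      using uv(3) by (auto simp: \<nu>_def split: if_splits)
    show "u = v"
    proof (cases "d 2 u = 0")
      case True
      then show ?thesis using lin0[of u] lin0[of v] uv(1,2) z by (intro const_diff U) (auto simp: d_def)
    next
      case False
      define s t where "s = d 2 u" and "t = d 2 v"
      have st: "s \<noteq> 0" "t \<noteq> 0" using False z by (auto simp: s_def t_def)
      define b f where "b = d 1 u / s" and "f = d 0 u / s"
      have b: "d 1 u = b * s" "d 0 u = f * s" using st by (auto simp: b_def f_def)
      have "b = d 1 v / t" "f = d 0 v / t"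
        using uv(3) False z unfolding \<nu>_def b_def f_def s_def t_def by (auto split: if_splits)
      then have b': "d 1 v = b * t" "d 0 v = f * t" using st by auto
      have e1: "poly u x - poly h x = s * (x\<^sup>2 + b * x + f)" for x
        unfolding val[OF uv(1)] b s_def[symmetric] by (simp add: algebra_simps)
      have e2: "poly v x - poly h x = t * (x\<^sup>2 + b * x + f)" for x
        unfolding val[OF uv(2)] b' t_def[symmetric] by (simp add: algebra_simps)
      have "poly u x - poly v x = (s - t) * (x\<^sup>2 + b * x + f)" for x
        using e1[of x] e2[of x] by (simp add: algebra_simps)
      moreover have "x\<^sup>2 + b * x + f \<noteq> 0" for x using ne[OF uv(1), of x] e1[of x] by auto
      ultimately have "s - t = 0" by (rule rootless_diff[OF U])
      then have "d 1 u = d 1 v" "d 2 u = d 2 v" using b b' by (simp_all add: s_def t_def)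
      then show ?thesis by (intro const_diff U) (simp_all add: d_def)
    qed
  qed
  moreover have "\<nu> ` miss h \<subseteq> insert None (Some ` R)"
  proof
    fix y assume "y \<in> \<nu> ` miss h"
    then obtain u where u: "u \<in> miss h" "y = \<nu> u" by blast
    show "y \<in> insert None (Some ` R)"
    proof (cases "d 2 u = 0")
      case True
      then show ?thesis using u by (simp add: \<nu>_def)
    next
      case False
      have "x\<^sup>2 + d 1 u / d 2 u * x + d 0 u / d 2 u \<noteq> 0" for x
      proof
        assume *: "x\<^sup>2 + d 1 u / d 2 u * x + d 0 u / d 2 u = 0"
        have "poly u x - poly h x = d 2 u *
            (x\<^sup>2 + d 1 u / d 2 u * x + d 0 u / d 2 u)"
          unfolding val[OF u(1)] using False by (simp add: distrib_left)
        with * ne[OF u(1), of x] show False by simp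
      qed
      then show ?thesis using False u(2) by (simp add: \<nu>_def R_def)
    qed
  qed
  ultimately have "card (miss h) \<le> card (insert None (Some ` R))"
    by (intro card_inj_on_le) auto
  also have "\<dots> \<le> Suc (card R)"
    by (simp add: card_insert_if card_image)
  finally show ?thesis using card_monic_rootless[where 'a = 'a] by (simp add: R_def)
qed

end

section \<open>Moments\<close>

lemma sum_UNIV_translate:
  fixes f :: "'a::{finite,group_add} \<Rightarrow> 'b::comm_monoid_add"
  shows "(\<Sum>t\<in>UNIV. f (a + t)) = sum f UNIV"
  by (rule sum.reindex_bij_witness[of _ "\<lambda>y. - a + y" "\<lambda>t. a + t"]) (auto simp: add.assoc[symmetric])

lemma sum_quadratics_point:
  fixes \<phi> :: "'a::{finite,field} \<Rightarrow> real"
  shows "(\<Sum>h\<in>polys_deg_le 2. \<phi> (poly h x)) = (real CARD('a))\<^sup>2 * (\<Sum>y\<in>UNIV. \<phi> y)"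
proof -
  have "(\<Sum>h\<in>polys_deg_le 2. \<phi> (poly h x)) = (\<Sum>y\<in>UNIV. \<Sum>h\<in>{h\<in>polys_deg_le 2. poly h x = y}. \<phi> (poly h x))"
    by (rule sum.group[symmetric]) auto
  also have "\<dots> = (\<Sum>y\<in>UNIV. \<Sum>h\<in>{h\<in>polys_deg_le 2. poly h x = y}. \<phi> y)"
    by (intro sum.cong) auto
  also have "\<dots> = (\<Sum>y\<in>UNIV. (real CARD('a))\<^sup>2 * \<phi> y)"
    using card_polys_through_point[of 1 x]
    by (simp add: numeral_2_eq_2)
  finally show ?thesis by (simp add: sum_distrib_left)
qed

text \<open>Translating \<open>h\<close> by multiples of a quadratic that vanishes at \<open>x2\<close> and \<open>x3\<close> but not at \<open>x1\<close>
  averages the first factor to zero.\<close>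

lemma sum_quadratics_isolated_point:
  fixes e :: "'a::{finite,field} \<Rightarrow> real"
  assumes e: "(\<Sum>y\<in>UNIV. e y) = 0" and x: "x1 \<noteq> x2" "x1 \<noteq> x3"
  shows "(\<Sum>h\<in>polys_deg_le 2. e (poly h x1) * G (poly h x2) (poly h x3)) = 0"
proof -
  define a where "a = inverse ((x1 - x2) * (x1 - x3))"
  define p where "p = smult a ([:-x2, 1:] * [:-x3, 1:])"
  have p: "poly p x1 = 1" "poly p x2 = 0" "poly p x3 = 0" "p \<in> polys_deg_le 2"
  proof -
    have "a * ((x1 - x2) * (x1 - x3)) = 1" using x unfolding a_def by (intro left_inverse) simp
    then show "poly p x1 = 1" by (simp add: p_def algebra_simps)
    show "poly p x2 = 0" "poly p x3 = 0" by (simp_all add: p_def algebra_simps)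
    have "p = [:a * (x2 * x3), a * (- x2 - x3), a:]" by (simp add: p_def algebra_simps)
    then show "p \<in> polys_deg_le 2" by (simp add: polys_deg_le_def)
  qed
  let ?F = "\<lambda>h. e (poly h x1) * G (poly h x2) (poly h x3)"
  let ?V = "polys_deg_le 2 :: 'a poly set"
  have tr: "sum ?F ?V = (\<Sum>h\<in>?V. ?F (h + smult t p))" for t
    by (rule sum.reindex_bij_witness[of _ "\<lambda>h. h + smult t p" "\<lambda>h. h - smult t p"])
      (simp_all add: polys_deg_le_closed polys_deg_le_smult p(4))
  have "(\<Sum>t\<in>(UNIV::'a set). sum ?F ?V) = (\<Sum>t\<in>UNIV. \<Sum>h\<in>?V. ?F (h + smult t p))"
    by (rule sum.cong[OF refl tr])
  also have "\<dots> = (\<Sum>h\<in>?V. \<Sum>t\<in>UNIV. e (poly h x1 + t) * G (poly h x2) (poly h x3))"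
    by (subst sum.swap) (simp add: p)
  also have "\<dots> = 0"
    by (simp add: sum_UNIV_translate e flip: sum_distrib_right)
  finally show ?thesis by simp
qed

locale centred_weights =
  fixes e :: "'a::{finite,field} \<Rightarrow> 'a \<Rightarrow> real"
  assumes centred: "(\<Sum>y\<in>UNIV. e x y) = 0"
begin

definition z :: "'a poly \<Rightarrow> real" where
  "z h = (\<Sum>x\<in>UNIV. e x (poly h x))"

text \<open>In the expanded square, two distinct columns contribute 0 by
  \<open>sum_quadratics_isolated_point\<close>, so only the diagonal remains.\<close>

lemma second_moment:
  "(\<Sum>h\<in>polys_deg_le 2. (z h)\<^sup>2) = (real CARD('a))\<^sup>2 * (\<Sum>x\<in>UNIV. \<Sum>y\<in>UNIV. (e x y)\<^sup>2)"
proof -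
  let ?V = "polys_deg_le 2 :: 'a poly set"
  have "(\<Sum>h\<in>?V. (z h)\<^sup>2) = (\<Sum>h\<in>?V. \<Sum>x\<in>UNIV. \<Sum>x'\<in>UNIV. e x (poly h x) * e x' (poly h x'))"
    by (simp add: z_def power2_eq_square sum_product)
  also have "\<dots> = (\<Sum>x\<in>UNIV. \<Sum>x'\<in>UNIV. \<Sum>h\<in>?V. e x (poly h x) * e x' (poly h x'))"
    by (subst sum.swap) (intro sum.cong refl sum.swap)
  also have "\<dots> = (\<Sum>x\<in>UNIV. \<Sum>x'\<in>UNIV. if x' = x then \<Sum>h\<in>?V. (e x (poly h x))\<^sup>2 else 0)"
  proof (intro sum.cong refl)
    fix x x' :: 'a
    show "(\<Sum>h\<in>?V. e x (poly h x) * e x' (poly h x')) = (if x' = x then \<Sum>h\<in>?V. (e x (poly h x))\<^sup>2 else 0)"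
      using sum_quadratics_isolated_point[OF centred, of x x' x' x "\<lambda>a b. e x' a"]
      by (auto simp: power2_eq_square)
  qed
  also have "\<dots> = (\<Sum>x\<in>UNIV. \<Sum>h\<in>?V. (e x (poly h x))\<^sup>2)" by simp
  finally show ?thesis by (simp add: sum_quadratics_point[where \<phi> = "\<lambda>y. (e _ y)\<^sup>2"] sum_distrib_left)
qed

text \<open>Of three columns that are not all equal, one differs from the other two, and its centred
  factor averages out. Degree 2 is just enough to separate three columns.\<close>

lemma third_moment:
  "(\<Sum>h\<in>polys_deg_le 2. (z h) ^ 3) = (real CARD('a))\<^sup>2 * (\<Sum>x\<in>UNIV. \<Sum>y\<in>UNIV. (e x y) ^ 3)"
proof -
  let ?V = "polys_deg_le 2 :: 'a poly set"
  let ?t = "\<lambda>x x' x'' h. e x (poly h x) * (e x' (poly h x') * e x'' (poly h x''))"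
  have "(\<Sum>h\<in>?V. (z h) ^ 3) = (\<Sum>h\<in>?V. \<Sum>x\<in>UNIV. \<Sum>x'\<in>UNIV. \<Sum>x''\<in>UNIV. ?t x x' x'' h)"
  proof -
    have "w ^ 3 = w * (w * w)" for w :: real by (simp add: power3_eq_cube)
    then show ?thesis by (simp only: z_def sum_product) (simp only: sum_distrib_left)
  qed
  also have "\<dots> = (\<Sum>x\<in>UNIV. \<Sum>h\<in>?V. \<Sum>x'\<in>UNIV. \<Sum>x''\<in>UNIV. ?t x x' x'' h)"
    by (rule sum.swap)
  also have "\<dots> = (\<Sum>x\<in>UNIV. \<Sum>x'\<in>UNIV. \<Sum>h\<in>?V. \<Sum>x''\<in>UNIV. ?t x x' x'' h)"
    by (intro sum.cong refl sum.swap)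
  also have "\<dots> = (\<Sum>x\<in>UNIV. \<Sum>x'\<in>UNIV. \<Sum>x''\<in>UNIV. \<Sum>h\<in>?V. ?t x x' x'' h)"
    by (intro sum.cong refl sum.swap)
  also have "\<dots> = (\<Sum>x\<in>UNIV. \<Sum>x'\<in>UNIV. \<Sum>x''\<in>UNIV. if x'' = x then if x' = x then \<Sum>h\<in>?V. (e x (poly h x)) ^ 3 else 0 else 0)"
  proof (intro sum.cong refl)
    fix x x' x'' :: 'a
    have "(\<Sum>h\<in>?V. ?t x x' x'' h) = 0" if "x \<noteq> x'" "x \<noteq> x''"
      using sum_quadratics_isolated_point[OF centred that, where G = "\<lambda>a b. e x' a * e x'' b"] .
    moreover have "(\<Sum>h\<in>?V. ?t x x' x'' h) = 0" if "x'' \<noteq> x" "x' = x"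
      using sum_quadratics_isolated_point[OF centred that(1) that(1), where G = "\<lambda>a b. e x a * e x b"] that(2)
      by (simp add: mult_ac)
    moreover have "(\<Sum>h\<in>?V. ?t x x' x'' h) = 0" if "x' \<noteq> x" "x'' = x"
      using sum_quadratics_isolated_point[OF centred that(1) that(1), where G = "\<lambda>a b. e x a * e x b"] that(2)
      by (simp add: mult_ac)
    ultimately show "(\<Sum>h\<in>?V. ?t x x' x'' h) =
        (if x'' = x then if x' = x then \<Sum>h\<in>?V. (e x (poly h x)) ^ 3 else 0 else 0)"
      by (auto simp: power3_eq_cube mult.assoc)
  qed
  also have "\<dots> = (\<Sum>x\<in>UNIV. \<Sum>h\<in>?V. (e x (poly h x)) ^ 3)" by simp
  finally show ?thesis by (simp add: sum_quadratics_point[where \<phi> = "\<lambda>y. (e _ y) ^ 3"] sum_distrib_left)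
qed

text \<open>The test function z^2 (z + B) is at least A (A + B) z on U and non-negative elsewhere.
  Summed over all quadratics it is at most q^2 (m + B) W by the two moments, with W the common value
  of the two sums in the hypothesis; then W > 0 cancels.\<close>

lemma moment_inequality:
  assumes U: "U \<subseteq> polys_deg_le 2" and W: "(\<Sum>u\<in>U. z u) = (\<Sum>x\<in>UNIV. \<Sum>y\<in>UNIV. (e x y)\<^sup>2)"
    and A: "\<And>u. u \<in> U \<Longrightarrow> z u \<ge> A" and A0: "A > 0" and ne: "U \<noteq> {}"
    and B: "\<And>h. h \<in> polys_deg_le 2 \<Longrightarrow> h \<notin> U \<Longrightarrow> z h \<ge> - B" and B0: "B \<ge> 0"
    and m: "\<And>x y. e x y \<le> m"
  shows "A * (A + B) - B * (real CARD('a))\<^sup>2 \<le> (real CARD('a))\<^sup>2 * m"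
proof -
  let ?V = "polys_deg_le 2 :: 'a poly set" and ?q = "real CARD('a)"
  define W where "W = (\<Sum>u\<in>U. z u)"
  have finU: "finite U" using U by (rule finite_subset) simp
  have "0 < (\<Sum>u\<in>U. A)" using finU ne A0 by (simp add: card_gt_0_iff)
  also have "\<dots> \<le> W" unfolding W_def by (intro sum_mono A)
  finally have W0: "W > 0" .
  have "A * (A + B) * W = (\<Sum>u\<in>U. A * (A + B) * z u)" by (simp add: W_def sum_distrib_left)
  also have "\<dots> \<le> (\<Sum>u\<in>U. (z u)\<^sup>2 * (z u + B))"
  proof (rule sum_mono)
    fix u assume "u \<in> U"
    then have z: "z u \<ge> A" by (rule A)
    then have "A * (A + B) \<le> z u * (z u + B)" using A0 B0 by (intro mult_mono) auto
    then have "A * (A + B) * z u \<le> z u * (z u + B) * z u" using z A0 by (intro mult_right_mono) auto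
    then show "A * (A + B) * z u \<le> (z u)\<^sup>2 * (z u + B)" by (simp add: power2_eq_square mult_ac)
  qed
  also have "\<dots> \<le> (\<Sum>h\<in>?V. (z h)\<^sup>2 * (z h + B))"
  proof (rule sum_mono2)
    fix h assume "h \<in> ?V - U"
    then have "z h + B \<ge> 0" using B[of h] by auto
    then show "0 \<le> (z h)\<^sup>2 * (z h + B)" by simp
  qed (use U in auto)
  also have "\<dots> = (\<Sum>h\<in>?V. (z h) ^ 3) + B * (\<Sum>h\<in>?V. (z h)\<^sup>2)"
    by (simp add: power2_eq_square power3_eq_cube distrib_left sum.distrib sum_distrib_left mult_ac)
  also have "(\<Sum>h\<in>?V. (z h)\<^sup>2) = ?q\<^sup>2 * W" unfolding second_moment W_def W ..
  also have "(\<Sum>h\<in>?V. (z h) ^ 3) \<le> ?q\<^sup>2 * (m * W)"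
  proof -
    have "(\<Sum>x\<in>UNIV. \<Sum>y\<in>UNIV. (e x y) ^ 3) \<le> (\<Sum>x\<in>UNIV. \<Sum>y\<in>UNIV. m * (e x y)\<^sup>2)"
    proof (intro sum_mono)
      fix x y
      have "(e x y) ^ 3 = e x y * (e x y)\<^sup>2" by (simp add: power3_eq_cube power2_eq_square)
      also have "\<dots> \<le> m * (e x y)\<^sup>2" by (intro mult_right_mono m) simp
      finally show "(e x y) ^ 3 \<le> m * (e x y)\<^sup>2" .
    qed
    then show ?thesis unfolding third_moment W_def W
      by (intro mult_left_mono) (simp_all add: sum_distrib_left)
  qed
  finally have "(A * (A + B) - B * ?q\<^sup>2) * W \<le> ?q\<^sup>2 * m * W" by (simp add: algebra_simps)
  then show ?thesis using W0 by simp
qed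

end

section \<open>Members in double contact with a quadratic\<close>

context intersecting_quadratics
begin

text \<open>For \<open>\<mu>\<close> in the field, the members with \<open>u'(x) - h'(x) = \<mu> (u(x) - h(x))\<close> form a plane
  containing \<open>tangent x h\<close>. Every such plane contains a rootless direction, so it has at most \<open>q\<close>
  members, and these planes cover everything that does not pass through \<open>(x, h(x))\<close>.\<close>

lemma card_tangent_le:
  assumes h: "h \<in> polys_deg_le 2"
  shows "CARD('a) * card (tangent x h) + card U \<le> card (through x (poly h x)) + CARD('a)\<^sup>2"
proof -
  \<comment> \<open>\<open>D u\<close> is the derivative of u at x, the middle coefficient in the
    expansion of \<open>quadratic_taylor\<close>.\<close>
  define D where "D u = coeff u 1 + 2 * coeff u 2 * x" for u :: "'a poly"
  define P where "P \<mu> = {u\<in>U. D u - D h = \<mu> * (poly u x - poly h x)}" for \<mu>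
  have cardP: "card (P \<mu>) \<le> CARD('a)" for \<mu>
  proof -
    obtain c where c: "\<And>z. c * z\<^sup>2 + \<mu> * z + 1 \<noteq> 0" using rootless_multiple_one[of \<mu>] by blast
    \<comment> \<open>The functional vanishes on the rootless direction c (z - x)^2 + \<mu> (z - x)
      + 1, along which the plane is projected.\<close>
    have "inj_on (\<lambda>u. coeff u 2 - c * poly u x) (P \<mu>)"
    proof (rule inj_onI)
      fix u v assume uv: "u \<in> P \<mu>" "v \<in> P \<mu>" "coeff u 2 - c * poly u x = coeff v 2 - c * poly v x"
      then have U: "u \<in> U" "v \<in> U" by (auto simp: P_def)
      define t where "t = poly u x - poly v x"
      have 1: "D u - D v = \<mu> * t"
      proof -
        have "D u - D v = (D u - D h) - (D v - D h)" by simp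
        also have "\<dots> = \<mu> * (poly u x - poly h x) - \<mu> * (poly v x - poly h x)" using uv by (simp add: P_def)
        also have "\<dots> = \<mu> * t" by (simp add: t_def algebra_simps)
        finally show ?thesis .
      qed
      have 2: "coeff u 2 - coeff v 2 = c * t" using uv(3) by (simp add: t_def algebra_simps)
      have "poly u z - poly v z = t + (D u - D v) * (z - x) + (coeff u 2 - coeff v 2) * (z - x)\<^sup>2" for z
      proof -
        have a: "poly u z = poly u x + D u * (z - x) + coeff u 2 * (z - x)\<^sup>2"
          "poly v z = poly v x + D v * (z - x) + coeff v 2 * (z - x)\<^sup>2"
          unfolding D_def by (rule quadratic_taylor[OF quadD[OF U(1)]], rule quadratic_taylor[OF quadD[OF U(2)]])
        show ?thesis unfolding a t_def by (simp add: left_diff_distrib)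
      qed
      then have "poly u z - poly v z = t * (c * (z - x)\<^sup>2 + \<mu> * (z - x) + 1)" for z
        unfolding 1 2 by (simp add: algebra_simps)
      from rootless_diff[OF U this c] have "t = 0" .
      then have "coeff u 2 = coeff v 2" "coeff u 1 = coeff v 1" using 1 2 by (auto simp: D_def)
      then show "u = v" by (intro const_diff U)
    qed
    then show ?thesis by (rule card_le_CARD_by_inj)
  qed
  have tang: "coeff u 2 = coeff h 2 + c \<and> poly u x = poly h x \<and> D u = D h"
    if "u = h + smult c ([:-x, 1:]\<^sup>2)" for u c
    using that by (simp add: D_def power2_eq_square numeral_2_eq_2 algebra_simps)
  have TP: "tangent x h \<subseteq> P \<mu>" for \<mu>
    using tang by (fastforce simp: tangent_def P_def)
  \<comment> \<open>The quotient below tells in which plane a member off (x, h(x)) lies. Each plane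
    contains \<open>tangent x h\<close> and so leaves room for at most q minus that many
    others.\<close>
  have "card (U - through x (poly h x)) \<le> CARD('a) * (CARD('a) - card (tangent x h))"
  proof (rule card_le_by_fibres[of _ "\<lambda>u. (D u - D h) / (poly u x - poly h x)" UNIV])
    fix \<mu> :: 'a
    have "{u \<in> U - through x (poly h x). (D u - D h) / (poly u x - poly h x) = \<mu>} \<subseteq> P \<mu> - tangent x h"
      using tang by (fastforce simp: through_def P_def tangent_def)
    then have "card {u \<in> U - through x (poly h x). (D u - D h) / (poly u x - poly h x) = \<mu>}
        \<le> card (P \<mu> - tangent x h)"
      by (intro card_mono) (simp_all add: P_def)
    also have "\<dots> = card (P \<mu>) - card (tangent x h)" by (intro card_Diff_subset TP) simp
    also have "\<dots> \<le> CARD('a) - card (tangent x h)" using cardP by (rule diff_le_mono)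
    finally show "card {u \<in> U - through x (poly h x). (D u - D h) / (poly u x - poly h x) = \<mu>}
        \<le> CARD('a) - card (tangent x h)" .
  qed simp_all
  moreover have "card U = card (U - through x (poly h x)) + card (through x (poly h x))"
    using card_Diff_subset[of "through x (poly h x)" U] card_mono[of U "through x (poly h x)"]
    by (auto simp: through_def)
  moreover have "card (tangent x h) \<le> CARD('a)"
    using card_mono[OF _ TP[of 0]] cardP[of 0] by (fastforce simp: P_def)
  moreover from this have "CARD('a) * card (tangent x h) \<le> CARD('a) * CARD('a)" by (rule mult_le_mono2)
  ultimately show ?thesis unfolding diff_mult_distrib2 power2_eq_square by linarith
qed

text \<open>A double contact at r puts u into \<open>tangent r h\<close>. If h is a member, it lies
  in all q tangent sets, which yields the extra q.\<close>

lemma card_dbl_le_tangent: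
  "card (dbl h) + CARD('a) * of_bool (h \<in> U) \<le> (\<Sum>x\<in>UNIV. card (tangent x h))"
proof -
  have "dbl h \<subseteq> (\<Union>x. tangent x h - {h})"
    by (auto simp: dbl_def tangent_def)
  then have "card (dbl h) \<le> card (\<Union>x. tangent x h - {h})" by (intro card_mono) auto
  also have "\<dots> \<le> (\<Sum>x\<in>UNIV. card (tangent x h - {h}))" by (intro card_UN_le) simp
  finally have "card (dbl h) + (\<Sum>x\<in>(UNIV::'a set). of_bool (h \<in> U))
      \<le> (\<Sum>x\<in>UNIV. card (tangent x h - {h}) + of_bool (h \<in> U))"
    unfolding sum.distrib by (rule add_right_mono)
  also have "\<dots> = (\<Sum>x\<in>UNIV. card (tangent x h))"
  proof (intro sum.cong refl)
    fix x
    have "h = h + smult 0 ([:-x, 1:]\<^sup>2)" by simp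
    then have "h \<in> tangent x h \<longleftrightarrow> h \<in> U" unfolding tangent_def by blast
    then show "card (tangent x h - {h}) + of_bool (h \<in> U) = card (tangent x h)"
      using card_Suc_Diff1[of "tangent x h" h] by (cases "h \<in> U") simp_all
  qed
  finally show ?thesis by simp
qed

text \<open>This is \<open>card_tangent_le\<close> summed over all columns. Here the weight bounds
  \<open>dbl\<close> from above, whereas \<open>weight_ge_member\<close> and
  \<open>weight_ge_nonmember\<close> bound the weight from below by means of \<open>dbl\<close>, so
  \<open>dbl\<close> can be eliminated.\<close>

lemma card_dbl_le:
  assumes h: "h \<in> polys_deg_le 2"
  shows "CARD('a) * card (dbl h) + CARD('a)\<^sup>2 * of_bool (h \<in> U) + CARD('a) * card U \<le> weight h + CARD('a) ^ 3"
proof -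
  have "CARD('a) * card (dbl h) + CARD('a)\<^sup>2 * of_bool (h \<in> U) + CARD('a) * card U
      \<le> CARD('a) * (\<Sum>x\<in>UNIV. card (tangent x h)) + CARD('a) * card U"
    using mult_le_mono2[OF card_dbl_le_tangent[of h], of "CARD('a)"]
    unfolding power2_eq_square distrib_left mult.assoc by (rule add_right_mono)
  also have "\<dots> = (\<Sum>x\<in>UNIV. CARD('a) * card (tangent x h) + card U)"
    by (simp add: sum.distrib sum_distrib_left)
  also have "\<dots> \<le> (\<Sum>x\<in>UNIV. card (through x (poly h x)) + CARD('a)\<^sup>2)"
    by (intro sum_mono card_tangent_le h)
  finally show ?thesis
    by (simp add: weight_def sum.distrib power3_eq_cube power2_eq_square)
qed

text \<open>In characteristic 2, (X - r)^2 = X^2 + r^2 has no linear term. Thus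
  \<open>card_coeff1_le\<close> bounds \<open>dbl\<close> without the detour through
  tangents.\<close>

lemma dbl_coeff1_char2:
  assumes "(2::'a) = 0"
  shows "dbl h \<subseteq> {u \<in> U. coeff u 1 = coeff h 1}"
proof -
  have "coeff ([:-r, 1:]\<^sup>2) 1 = 0" for r :: 'a
  proof -
    have "r + r = 0" using assms by (metis mult_2 mult_zero_left)
    then have "- r + - r = 0" by (metis minus_add_distrib minus_zero)
    then show ?thesis by (simp add: power2_eq_square)
  qed
  then have "coeff u 1 = coeff h 1" if "u = h + smult c ([:-r, 1:]\<^sup>2)" for u c r
    unfolding that by simp
  then show ?thesis unfolding dbl_def by blast
qed

lemma card_dbl_le_char2:
  assumes "(2::'a) = 0"
  shows "card (dbl h) + of_bool (h \<in> U) \<le> CARD('a)"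
proof -
  have "dbl h \<union> (if h \<in> U then {h} else {}) \<subseteq> {u \<in> U. coeff u 1 = coeff h 1}"
    using dbl_coeff1_char2[OF assms, of h] by auto
  from card_mono[OF _ this] card_coeff1_le[of "coeff h 1"]
  have "card (dbl h \<union> (if h \<in> U then {h} else {})) \<le> CARD('a)" by simp
  moreover have "h \<notin> dbl h" by (simp add: dbl_def)
  ultimately show ?thesis by (auto split: if_splits)
qed

end

section \<open>The quadratic case\<close>

lemma power_CARD_eq_self:
  fixes x :: "'a::{finite,field}"
  shows "x ^ CARD('a) = x"
proof (cases "x = 0")
  case False
  let ?S = "UNIV - {0::'a}"
  have "(\<Prod>y\<in>?S. x * y) = \<Prod>?S"
    by (rule prod.reindex_bij_witness[of _ "\<lambda>y. y / x" "\<lambda>y. x * y"]) (use False in auto)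
  then have "x ^ card ?S * \<Prod>?S = \<Prod>?S" by (simp add: prod.distrib)
  moreover have "\<Prod>?S \<noteq> 0" by simp
  ultimately have "x ^ card ?S = 1" by (metis mult_cancel_right1)
  moreover have "CARD('a) = Suc (card ?S)" by (rule card.remove) auto
  ultimately show ?thesis by (simp only: power_Suc mult_1_right)
qed simp

context intersecting_quadratics
begin

text \<open>Every u through (x, y) meets h outside column x, and in each of the other q - 1 columns
  at most q such u do so, since two points are prescribed. Almost every u uses two of these
  columns.\<close>

lemma card_through_le:
  assumes h: "h \<in> U" "poly h x \<noteq> y"
  shows "2 * card (through x y) \<le> (CARD('a) - 1) * CARD('a)
      + card (through x y \<inter> lin h) + card (through x y \<inter> dbl h)"
proof -
  let ?S = "through x y"
  have "2 * card (?S - miss h) \<le> (\<Sum>u\<in>?S. card (meet h u)) + card (?S \<inter> lin h) + card (?S \<inter> dbl h)"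
    by (rule sum_meet_ge) (use h quadD in \<open>auto simp: through_def\<close>)
  moreover have "?S - miss h = ?S"
    using inter h(1) by (auto simp: through_def miss_def meet_def intersecting_def)
  moreover have "(\<Sum>u\<in>?S. card (meet h u)) \<le> (CARD('a) - 1) * CARD('a)"
  proof -
    have "(\<Sum>u\<in>?S. card (meet h u)) = (\<Sum>x'\<in>UNIV. card {u \<in> ?S. poly u x' = poly h x'})"
      by (simp add: sum_card_meet)
    also have "\<dots> = (\<Sum>x'\<in>UNIV - {x}. card {u \<in> ?S. poly u x' = poly h x'})"
      using h(2) by (intro sum.mono_neutral_right) (auto simp: through_def)
    also have "\<dots> \<le> (\<Sum>x'\<in>UNIV - {x}. CARD('a))"
    proof (rule sum_mono)
      fix x' assume "x' \<in> UNIV - {x}"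
      have "card {u \<in> ?S. poly u x' = poly h x'}
          \<le> card {p \<in> polys_deg_le (Suc (Suc 0)). poly p x = y \<and> poly p x' = poly h x'}"
        using quadD by (intro card_mono) (auto simp: through_def numeral_2_eq_2)
      also have "\<dots> \<le> CARD('a) ^ Suc 0"
        using \<open>x' \<in> UNIV - {x}\<close> by (intro card_polys_through_two_points) auto
      finally show "card {u \<in> ?S. poly u x' = poly h x'} \<le> CARD('a)" by simp
    qed
    finally show ?thesis by (simp add: card_Diff_singleton)
  qed
  ultimately show ?thesis by simp
qed

lemma card_through_lin_le:
  assumes h: "h \<in> U" "poly h x \<noteq> y"
  shows "card (through x y \<inter> lin h) \<le> CARD('a) - 1"
proof -
  have "card (through x y \<inter> lin h) \<le> card (UNIV - {coeff h 1})"
  proof (rule card_inj_on_le[of "\<lambda>u. coeff u 1"])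
    show "inj_on (\<lambda>u. coeff u 1) (through x y \<inter> lin h)"
      by (auto simp: through_def lin_def intro!: inj_onI const_diff)
    show "(\<lambda>u. coeff u 1) ` (through x y \<inter> lin h) \<subseteq> UNIV - {coeff h 1}"
      using const_diff[OF _ h(1)] by (auto simp: lin_def)
  qed simp
  then show ?thesis by (simp add: card_Diff_singleton)
qed

text \<open>The contact abscissa r determines u, as c is fixed by the value y at x; r = x is
  impossible because h avoids (x, y).\<close>

lemma card_through_dbl_le:
  assumes h: "poly h x \<noteq> y"
  shows "card (through x y \<inter> dbl h) \<le> CARD('a) - 1"
proof -
  let ?g = "\<lambda>r. h + smult ((y - poly h x) / (x - r)\<^sup>2) ([:-r, 1:]\<^sup>2)"
  have "through x y \<inter> dbl h \<subseteq> ?g ` (UNIV - {x})"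
  proof
    fix u assume "u \<in> through x y \<inter> dbl h"
    then obtain c r where u: "poly u x = y" "u = h + smult c ([:-r, 1:]\<^sup>2)"
      by (auto simp: through_def dbl_def)
    then have y: "y - poly h x = c * (x - r)\<^sup>2" by (simp add: algebra_simps)
    with h have "r \<noteq> x" by auto
    with y have "c = (y - poly h x) / (x - r)\<^sup>2" by simp
    with u(2) \<open>r \<noteq> x\<close> show "u \<in> ?g ` (UNIV - {x})" by blast
  qed
  then have "card (through x y \<inter> dbl h) \<le> card (?g ` (UNIV - {x}))" by (intro card_mono) auto
  also have "\<dots> \<le> card (UNIV - {x})" by (intro card_image_le) simp
  finally show ?thesis by (simp add: card_Diff_singleton)
qed

lemma common_point_if_large:
  assumes "(CARD('a) - 1) * (CARD('a) + 2) < 2 * card (through x y)"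
  shows "\<forall>h\<in>U. poly h x = y"
proof (rule ccontr)
  assume "\<not> ?thesis"
  then obtain h where h: "h \<in> U" "poly h x \<noteq> y" by blast
  have "2 * card (through x y) \<le> (CARD('a) - 1) * CARD('a) + (CARD('a) - 1) + (CARD('a) - 1)"
    using card_through_le[OF h] card_through_lin_le[OF h] card_through_dbl_le[OF h(2)] by linarith
  also have "\<dots> = (CARD('a) - 1) * (CARD('a) + 2)" by (simp add: algebra_simps)
  finally show False using assms by simp
qed

section \<open>Excess over the average, and the comparison of moments\<close>

definition excess :: "'a \<Rightarrow> 'a \<Rightarrow> real" where
  "excess x y = real (card (through x y)) - real (card U) / real CARD('a)"

lemma sum_through: "(\<Sum>y\<in>UNIV. card (through x y)) = card U"
  using sum.group[of U UNIV "\<lambda>u. poly u x" "\<lambda>_. 1::nat"] by (simp add: through_def)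

lemma sum_excess: "(\<Sum>y\<in>UNIV. excess x y) = 0"
  by (simp add: excess_def sum_subtractf sum_through flip: of_nat_sum)

lemma sum_excess_weight: "(\<Sum>x\<in>UNIV. excess x (poly h x)) = real (weight h) - real (card U)"
  by (simp add: excess_def sum_subtractf weight_def)

text \<open>Grouping U by the value at x weights \<open>excess x y\<close> with
  \<open>excess x y\<close> + N/q, and the constant part sums to 0. This is the hypothesis
  \<open>W\<close> of \<open>moment_inequality\<close>.\<close>

lemma sum_excess_members:
  "(\<Sum>u\<in>U. \<Sum>x\<in>UNIV. excess x (poly u x)) = (\<Sum>x\<in>UNIV. \<Sum>y\<in>UNIV. (excess x y)\<^sup>2)"
proof -
  have "(\<Sum>u\<in>U. excess x (poly u x)) = (\<Sum>y\<in>UNIV. (excess x y)\<^sup>2)" for x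
  proof -
    have "(\<Sum>u\<in>U. excess x (poly u x)) = (\<Sum>y\<in>UNIV. \<Sum>u\<in>{u\<in>U. poly u x = y}. excess x (poly u x))"
      by (rule sum.group[symmetric]) auto
    also have "\<dots> = (\<Sum>y\<in>UNIV. card (through x y) * excess x y)"
      by (intro sum.cong refl) (simp add: through_def)
    also have "\<dots> = (\<Sum>y\<in>UNIV. (excess x y)\<^sup>2 + real (card U) / real CARD('a) * excess x y)"
      by (intro sum.cong refl) (simp add: excess_def power2_eq_square algebra_simps)
    also have "\<dots> = (\<Sum>y\<in>UNIV. (excess x y)\<^sup>2)"
      by (simp only: sum.distrib sum_excess mult_zero_right add_0_right flip: sum_distrib_left)
    finally show ?thesis .
  qed
  then show ?thesis by (subst sum.swap) simp
qed

text \<open>Without a common point, \<open>common_point_if_large\<close> caps every excess at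
  \<open>?m\<close>. The hypothesis \<open>num\<close> contradicts \<open>moment_inequality\<close>
  for this cap.\<close>

lemma common_point_if_weights:
  fixes A B :: real
  assumes A: "\<And>u. u \<in> U \<Longrightarrow> real (weight u) - real (card U) \<ge> A" and A0: "A > 0" and ne: "U \<noteq> {}"
    and B: "\<And>h. h \<in> polys_deg_le 2 \<Longrightarrow> h \<notin> U \<Longrightarrow> real (weight h) - real (card U) \<ge> - B" and B0: "B \<ge> 0"
    and num: "A * (A + B) - B * (real CARD('a))\<^sup>2
      > (real CARD('a))\<^sup>2 * ((real CARD('a) - 1) * (real CARD('a) + 2) / 2) - real CARD('a) * real (card U)"
  shows "\<exists>\<alpha> \<beta>. \<forall>g\<in>U. poly g \<alpha> = \<beta>"
proof (rule ccontr)
  assume no: "\<not> ?thesis"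
  let ?q = "real CARD('a)"
  let ?m = "(?q - 1) * (?q + 2) / 2 - real (card U) / ?q"
  interpret centred_weights excess by unfold_locales (rule sum_excess)
  have z: "z h = real (weight h) - real (card U)" for h unfolding z_def by (rule sum_excess_weight)
  have "excess x y \<le> ?m" for x y
  proof -
    have "\<not> (CARD('a) - 1) * (CARD('a) + 2) < 2 * card (through x y)"
      using common_point_if_large no by blast
    then have "real (2 * card (through x y)) \<le> real ((CARD('a) - 1) * (CARD('a) + 2))"
      by (simp only: not_less of_nat_le_iff)
    then have "2 * real (card (through x y)) \<le> (?q - 1) * (?q + 2)"
      by (simp only: of_nat_mult of_nat_add of_nat_numeral of_nat_diff[OF one_le_card_finite[unfolded One_nat_def[symmetric]]] of_nat_1)
    then show ?thesis by (simp add: excess_def)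
  qed
  then have "A * (A + B) - B * ?q\<^sup>2 \<le> ?q\<^sup>2 * ?m"
    using A B sum_excess_members
    by (intro moment_inequality[OF quad _ _ A0 ne _ B0]) (auto simp: z simp flip: z_def)
  also have "\<dots> = ?q\<^sup>2 * ((?q - 1) * (?q + 2) / 2) - ?q * real (card U)"
    by (simp add: power2_eq_square right_diff_distrib)
  finally show False using num by simp
qed

text \<open>Combining q times \<open>weight_ge_member\<close> with \<open>card_dbl_le\<close>
  eliminates \<open>dbl\<close>. Integrality gives N \<ge> q^2 - q + 1, and the remainder q - 5 left
  after factoring out q + 1 is non-negative.\<close>

lemma weight_real_member:
  assumes u: "u \<in> U" and N: "CARD('a)\<^sup>2 - CARD('a) < card U" and q: "CARD('a) \<ge> 5"
  shows "real (weight u) - real (card U) \<ge> (real CARD('a))\<^sup>2 - 3 * real CARD('a) + 4"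
proof -
  define q N w l d where "q = real CARD('a)" and "N = real (card U)" and "w = real (weight u)"
    and "l = real (card (lin u))" and "d = real (card (dbl u))"
  have q5: "q \<ge> 5" using q by (simp add: q_def)
  have "CARD('a)\<^sup>2 + 1 \<le> card U + CARD('a)" using N by linarith
  then have "real (CARD('a)\<^sup>2 + 1) \<le> real (card U + CARD('a))" by (rule of_nat_mono)
  then have N': "N \<ge> q\<^sup>2 - q + 1" by (simp add: q_def N_def)
  have 1: "w + l + d + 2 \<ge> q + 2 * N"
    using of_nat_mono[OF weight_ge_member[OF u], where 'a = real]
    by (simp add: q_def N_def w_def l_def d_def)
  have 2: "l + 1 \<le> q" using of_nat_mono[OF card_lin_le[of u], where 'a = real] u by (simp add: l_def q_def)
  have 3: "q * d + q\<^sup>2 + q * N \<le> w + q ^ 3"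
    using of_nat_mono[OF card_dbl_le[OF quadD[OF u]], where 'a = real] u by (simp add: q_def d_def N_def w_def)
  have "q * (w + d) \<ge> q * (2 * N - 1)" using 1 2 q5 by (intro mult_left_mono) auto
  with 3 have 4: "(q + 1) * w \<ge> 3 * (q * N) - q + q\<^sup>2 - q ^ 3" by (simp add: algebra_simps)
  have "(2 * q - 1) * N \<ge> (2 * q - 1) * (q\<^sup>2 - q + 1)" using N' q5 by (intro mult_left_mono) auto
  then have "(q + 1) * (w - N) \<ge> (2 * q - 1) * (q\<^sup>2 - q + 1) - q ^ 3 + q\<^sup>2 - q"
    using 4 by (simp add: algebra_simps)
  also have "(2 * q - 1) * (q\<^sup>2 - q + 1) - q ^ 3 + q\<^sup>2 - q = (q + 1) * (q\<^sup>2 - 3 * q + 4) + (q - 5)"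
    by (simp add: algebra_simps power2_eq_square power3_eq_cube)
  finally have "(q + 1) * (q\<^sup>2 - 3 * q + 4) \<le> (q + 1) * (w - N)" using q5 by linarith
  then have "q\<^sup>2 - 3 * q + 4 \<le> w - N" by (rule mult_left_le_imp_le) (use q5 in simp)
  then show ?thesis by (simp add: q_def w_def N_def)
qed

text \<open>The same elimination, with \<open>card_miss_le\<close> for the missed members; here the
  remainder is q - 4.\<close>

lemma weight_real_nonmember:
  assumes h: "h \<in> polys_deg_le 2" "h \<notin> U" and N: "CARD('a)\<^sup>2 - CARD('a) < card U" and q: "CARD('a) \<ge> 4"
  shows "real (weight h) - real (card U) \<ge> - (3 * real CARD('a) - 3)"
proof -
  define q N w l d e where "q = real CARD('a)" and "N = real (card U)" and "w = real (weight h)"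
    and "l = real (card (lin h))" and "d = real (card (dbl h))" and "e = real (card (miss h))"
  have q4: "q \<ge> 4" using q by (simp add: q_def)
  have "CARD('a)\<^sup>2 + 1 \<le> card U + CARD('a)" using N by linarith
  then have "real (CARD('a)\<^sup>2 + 1) \<le> real (card U + CARD('a))" by (rule of_nat_mono)
  then have N': "N \<ge> q\<^sup>2 - q + 1" by (simp add: q_def N_def)
  have 1: "w + l + d + 2 * e \<ge> 2 * N"
    using of_nat_mono[OF weight_ge_nonmember[OF h], where 'a = real] by (simp add: q_def N_def w_def l_def d_def e_def)
  have 2: "l \<le> q" using of_nat_mono[OF card_lin_le[of h], where 'a = real] h(2) by (simp add: l_def q_def)
  have 3: "q * d + q * N \<le> w + q ^ 3"
    using of_nat_mono[OF card_dbl_le[OF h(1)], where 'a = real] h(2) by (simp add: q_def d_def N_def w_def)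
  have 5: "2 * e + q \<le> q\<^sup>2 + 2"
    using of_nat_mono[OF card_miss_le[OF h(1)], where 'a = real] by (simp add: q_def e_def)
  have "q * (w + d) \<ge> q * (2 * N - q\<^sup>2 - 2)" using 1 2 5 q4 by (intro mult_left_mono) auto
  with 3 have 4: "(q + 1) * w \<ge> 3 * (q * N) - 2 * q ^ 3 - 2 * q"
    by (simp add: algebra_simps power2_eq_square power3_eq_cube)
  have "(2 * q - 1) * N \<ge> (2 * q - 1) * (q\<^sup>2 - q + 1)" using N' q4 by (intro mult_left_mono) auto
  then have "(q + 1) * (w - N) \<ge> (2 * q - 1) * (q\<^sup>2 - q + 1) - 2 * q ^ 3 - 2 * q"
    using 4 by (simp add: algebra_simps)
  also have "(2 * q - 1) * (q\<^sup>2 - q + 1) - 2 * q ^ 3 - 2 * q = (q + 1) * (- (3 * q - 3)) + (q - 4)"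
    by (simp add: algebra_simps power2_eq_square power3_eq_cube)
  finally have "(q + 1) * (- (3 * q - 3)) \<le> (q + 1) * (w - N)" using q4 by linarith
  then have "- (3 * q - 3) \<le> w - N" by (rule mult_left_le_imp_le) (use q4 in simp)
  then show ?thesis by (simp add: q_def w_def N_def)
qed

text \<open>With A and B from the two preceding lemmas, A + B = q^2 + 1, and the margin in
  \<open>num\<close> is at least q^3 (q - 11)/2 plus positive terms, which is where 11 comes
  from.\<close>

lemma common_point_ge_11:
  assumes N: "CARD('a)\<^sup>2 - CARD('a) < card U" and q: "CARD('a) \<ge> 11"
  shows "\<exists>\<alpha> \<beta>. \<forall>g\<in>U. poly g \<alpha> = \<beta>"
proof (rule common_point_if_weights)
  let ?q = "real CARD('a)"
  let ?A = "?q\<^sup>2 - 3 * ?q + 4" and ?B = "3 * ?q - 3"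
  define q where "q = ?q"
  have q11: "q \<ge> 11" using q by (simp add: q_def)
  have "CARD('a)\<^sup>2 + 1 \<le> card U + CARD('a)" using N by linarith
  then have "real (CARD('a)\<^sup>2 + 1) \<le> real (card U + CARD('a))" by (rule of_nat_mono)
  then have N': "real (card U) \<ge> q\<^sup>2 - q + 1" by (simp add: q_def)
  show "real (weight u) - real (card U) \<ge> ?A" if "u \<in> U" for u
    using weight_real_member[OF that N] q by simp
  show "real (weight h) - real (card U) \<ge> - ?B" if "h \<in> polys_deg_le 2" "h \<notin> U" for h
    using weight_real_nonmember[OF that N] q by simp
  have "q * q \<ge> 3 * q" using q11 by (intro mult_right_mono) auto
  then show "?A > 0" unfolding q_def[symmetric] power2_eq_square by linarith
  show "?B \<ge> 0" using q11 by (simp add: q_def)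
  show "U \<noteq> {}" using N by auto
  have "q * real (card U) \<ge> q * (q\<^sup>2 - q + 1)" using N' q11 by (intro mult_left_mono) auto
  moreover have "(q\<^sup>2 - 3 * q + 4) * ((q\<^sup>2 - 3 * q + 4) + (3 * q - 3)) - (3 * q - 3) * q\<^sup>2
      - (q\<^sup>2 * ((q - 1) * (q + 2) / 2) - q * (q\<^sup>2 - q + 1)) = q ^ 3 * (q - 11) / 2 + 2 * q * (4 * q - 1) + 4"
    by (simp add: field_simps power2_eq_square power3_eq_cube)
  moreover have "q ^ 3 * (q - 11) / 2 + 2 * q * (4 * q - 1) + 4 > 0"
    using q11 by (intro add_nonneg_pos add_nonneg_nonneg) auto
  ultimately show "?A * (?A + ?B) - ?B * ?q\<^sup>2 > ?q\<^sup>2 * ((?q - 1) * (?q + 2) / 2) - ?q * real (card U)"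
    unfolding q_def[symmetric] by linarith
qed

text \<open>\<open>card_dbl_le_char2\<close> gives better A and B at once; now A + B = q^2 + 2 and
  the margin starts with q^3 (q - 7)/2.\<close>

lemma common_point_char2:
  assumes two: "(2::'a) = 0" and N: "CARD('a)\<^sup>2 - CARD('a) < card U" and q: "CARD('a) \<ge> 7"
  shows "\<exists>\<alpha> \<beta>. \<forall>g\<in>U. poly g \<alpha> = \<beta>"
proof (rule common_point_if_weights)
  let ?q = "real CARD('a)"
  let ?A = "?q\<^sup>2 - 2 * ?q + 1" and ?B = "2 * ?q + 1"
  define q where "q = ?q"
  have q7: "q \<ge> 7" using q by (simp add: q_def)
  have "CARD('a)\<^sup>2 + 1 \<le> card U + CARD('a)" using N by linarith
  then have "real (CARD('a)\<^sup>2 + 1) \<le> real (card U + CARD('a))" by (rule of_nat_mono)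
  then have N': "real (card U) \<ge> q\<^sup>2 - q + 1" by (simp add: q_def)
  show "real (weight u) - real (card U) \<ge> ?A" if "u \<in> U" for u
  proof -
    have "q + 2 * real (card U) \<le> real (weight u) + real (card (lin u)) + real (card (dbl u)) + 2"
      using of_nat_mono[OF weight_ge_member[OF that], where 'a = real] by (simp add: q_def)
    moreover have "real (card (lin u)) + 1 \<le> q" "real (card (dbl u)) + 1 \<le> q"
      using of_nat_mono[OF card_lin_le[of u], where 'a = real]
        of_nat_mono[OF card_dbl_le_char2[OF two, of u], where 'a = real] that by (simp_all add: q_def)
    ultimately show ?thesis using N' unfolding q_def[symmetric] by linarith
  qed
  show "real (weight h) - real (card U) \<ge> - ?B" if "h \<in> polys_deg_le 2" "h \<notin> U" for h
  proof -
    have "2 * real (card U) \<le> real (weight h) + real (card (lin h)) + real (card (dbl h)) + 2 * real (card (miss h))"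
      using of_nat_mono[OF weight_ge_nonmember[OF that], where 'a = real] by simp
    moreover have "real (card (lin h)) \<le> q" "real (card (dbl h)) \<le> q"
      using of_nat_mono[OF card_lin_le[of h], where 'a = real]
        of_nat_mono[OF card_dbl_le_char2[OF two, of h], where 'a = real] that by (simp_all add: q_def)
    moreover have "2 * real (card (miss h)) + q \<le> q\<^sup>2 + 2"
      using of_nat_mono[OF card_miss_le[OF that(1)], where 'a = real] by (simp add: q_def)
    ultimately show ?thesis using N' unfolding q_def[symmetric] by linarith
  qed
  have "q * q \<ge> 2 * q" using q7 by (intro mult_right_mono) auto
  then show "?A > 0" unfolding q_def[symmetric] power2_eq_square by linarith
  show "?B \<ge> 0" by simp
  show "U \<noteq> {}" using N by auto
  have "q * real (card U) \<ge> q * (q\<^sup>2 - q + 1)" using N' q7 by (intro mult_left_mono) auto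
  moreover have "(q\<^sup>2 - 2 * q + 1) * ((q\<^sup>2 - 2 * q + 1) + (2 * q + 1)) - (2 * q + 1) * q\<^sup>2
      - (q\<^sup>2 * ((q - 1) * (q + 2) / 2) - q * (q\<^sup>2 - q + 1)) = q ^ 3 * (q - 7) / 2 + q * (2 * q - 3) + 2"
    by (simp add: field_simps power2_eq_square power3_eq_cube)
  moreover have "q ^ 3 * (q - 7) / 2 + q * (2 * q - 3) + 2 > 0"
    using q7 by (intro add_nonneg_pos add_nonneg_nonneg) auto
  ultimately show "?A * (?A + ?B) - ?B * ?q\<^sup>2 > ?q\<^sup>2 * ((?q - 1) * (?q + 2) / 2) - ?q * real (card U)"
    unfolding q_def[symmetric] by linarith
qed

section \<open>The field with four elements\<close>

lemma common_point_card4_large: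
  assumes two: "(2::'a) = 0" and q: "CARD('a) = 4" and N: "card U \<ge> 13"
    and P: "card (through x y) \<ge> 9"
  shows "\<forall>h\<in>U. poly h x = y"
proof (rule ccontr)
  assume no: "\<not> ?thesis"
  let ?S = "through x y"
  define C where "C b = {u \<in> ?S. coeff u 1 = b}" for b
  have finC [simp]: "finite (C b)" for b by (simp add: C_def)
  have dblC: "?S \<inter> dbl h \<subseteq> C (coeff h 1)" for h
    using dbl_coeff1_char2[OF two, of h] by (auto simp: C_def)
  \<comment> \<open>The bound 2 |S| \<le> 12 + 3 + 3 leaves no slack at |S| = 9, so at least three
    members of S are in double contact with h and share its coefficient of X.\<close>
  have upper: "card ?S \<le> 9 \<and> card (C (coeff h 1)) \<ge> 3" if h: "h \<in> U" "poly h x \<noteq> y" for h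
    using card_through_le[OF h] card_through_lin_le[OF h] card_through_dbl_le[OF h(2)]
      card_mono[OF finC dblC, of h] P q by simp
  obtain h0 where "h0 \<in> U" "poly h0 x \<noteq> y" using no by blast
  then have card9: "card ?S = 9" using upper P by force
  define R where "R = U - ?S"
  have "card U = card R + card ?S"
    using card_Diff_subset[of ?S U] card_mono[of U ?S] by (auto simp: R_def through_def)
  then have cardR: "card R \<ge> 4" using N card9 by simp
  have RD: "h \<in> U \<and> poly h x \<noteq> y" if "h \<in> R" for h using that by (auto simp: R_def through_def)
  \<comment> \<open>Two members off the point with the same coefficient of X would join at least
    three of S in a class of at most q = 4 members.\<close>
  have "inj_on (\<lambda>h. coeff h 1) R"
  proof (rule inj_onI, rule ccontr)
    fix h h' assume h: "h \<in> R" "h' \<in> R" "coeff h 1 = coeff h' 1" "h \<noteq> h'"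
    have "C (coeff h 1) \<inter> {h, h'} = {}" using RD[OF h(1)] RD[OF h(2)] by (auto simp: C_def through_def)
    then have "card (C (coeff h 1) \<union> {h, h'}) = card (C (coeff h 1)) + 2"
      using h(4) by (subst card_Un_disjoint) auto
    moreover have "C (coeff h 1) \<union> {h, h'} \<subseteq> {u \<in> U. coeff u 1 = coeff h 1}"
      using RD[OF h(1)] RD[OF h(2)] h(3) by (auto simp: C_def through_def)
    then have "card (C (coeff h 1) \<union> {h, h'}) \<le> card {u \<in> U. coeff u 1 = coeff h 1}"
      by (intro card_mono) auto
    moreover have "card {u \<in> U. coeff u 1 = coeff h 1} \<le> 4" using card_coeff1_le[of "coeff h 1"] q by simp
    moreover have "card (C (coeff h 1)) \<ge> 3" using upper RD[OF h(1)] by blast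
    ultimately show False by simp
  qed
  then have "card ((\<lambda>h. coeff h 1) ` R) \<ge> CARD('a)" using cardR q by (simp add: card_image)
  then have surj: "(\<lambda>h. coeff h 1) ` R = UNIV" by (intro card_seteq) auto
  \<comment> \<open>All four coefficients of X occur outside S, so each class in S has at least
    three members, making 12 > 9.\<close>
  have "card (C b) \<ge> 3" for b
  proof -
    obtain h where "h \<in> R" "coeff h 1 = b" using surj by (metis UNIV_I imageE)
    then show ?thesis using upper RD by blast
  qed
  then have "(\<Sum>b\<in>(UNIV::'a set). 3) \<le> (\<Sum>b\<in>UNIV. card (C b))" by (intro sum_mono)
  also have "\<dots> = card ?S"
    using sum.group[of ?S UNIV "\<lambda>u. coeff u 1" "\<lambda>_. 1::nat"] by (simp add: C_def)
  finally show False using card9 q by simp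
qed

text \<open>In the field with four elements \<open>X\<^sup>2 + X\<close> only takes the values \<open>0\<close> and \<open>1\<close>. This forces
  the members of a full plane \<open>c = b + \<tau>\<close> onto a line \<open>g + b (X\<^sup>2 + X + m)\<close>. All its members
  pass through two common points, and every other member of \<open>U\<close> must pass through one of them.\<close>

lemma common_point_card4:
  assumes two: "(2::'a) = 0" and q: "CARD('a) = 4" and N: "CARD('a)\<^sup>2 - CARD('a) < card U"
  shows "\<exists>\<alpha> \<beta>. \<forall>g\<in>U. poly g \<alpha> = \<beta>"
proof -
  have add2: "a + a = 0" for a :: 'a using two by (metis mult_2 mult_zero_left)
  have neg: "- a = a" for a :: 'a using add2[of a] by (simp add: minus_unique)
  have sub: "a - b = a + b" for a b :: 'a using neg[of b] by (metis add_uminus_conv_diff)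
  have pow4: "a ^ 4 = a" for a :: 'a using power_CARD_eq_self[of a] q by simp
  have N13: "card U \<ge> 13" using N q by simp
  have "\<exists>\<tau>. card {u \<in> U. coeff u 2 - coeff u 1 = \<tau>} \<ge> 4"
  proof (rule ccontr)
    assume "\<not> ?thesis"
    then have "card {u \<in> U. coeff u 2 - coeff u 1 = \<tau>} < 4" for \<tau> by (simp add: not_le)
    then have "card {u \<in> U. coeff u 2 - coeff u 1 = \<tau>} \<le> 3" for \<tau>
      using less_Suc_eq_le[of _ 3] by simp
    then have "card U \<le> CARD('a) * 3"
      by (intro card_le_by_fibres[of U "\<lambda>u. coeff u 2 - coeff u 1" UNIV 3]) auto
    with N13 q show False by simp
  qed
  then obtain \<tau> where \<tau>: "card {u \<in> U. coeff u 2 - coeff u 1 = \<tau>} \<ge> 4" by blast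
  define L where "L = {u \<in> U. coeff u 2 - coeff u 1 = \<tau>}"
  have L: "u \<in> U" "coeff u 2 = coeff u 1 + \<tau>" if "u \<in> L" for u
    using that by (auto simp: L_def)
  have "inj_on (\<lambda>u. coeff u 1) L" by (rule inj_onI) (auto intro: const_diff simp: L)
  then have "card ((\<lambda>u. coeff u 1) ` L) \<ge> CARD('a)" using \<tau> q by (simp add: card_image L_def)
  then have "(\<lambda>u. coeff u 1) ` L = UNIV" by (intro card_seteq) auto
  then have "\<forall>b. \<exists>u\<in>L. coeff u 1 = b" by (metis UNIV_I imageE)
  then obtain g where g: "\<And>b. g b \<in> L" "\<And>b. coeff (g b) 1 = b" by metis
  define f where "f b = coeff (g b) 0" for b
  have ev: "poly (g b) t = f b + b * t + (b + \<tau>) * t\<^sup>2" for b t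
    using quadratic_taylor[OF quadD[OF L(1)[OF g(1)]], of b t 0] L(2)[OF g(1), of b] g(2)[of b]
    by (simp add: f_def poly_0_coeff_0)
  \<comment> \<open>In the plane the X^2- and X-coefficients differ by the same amount b - b', hence
    the factor X^2 + X; its sign is absorbed by characteristic 2.\<close>
  have meetg: "\<exists>X. f b - f b' = (b - b') * (X\<^sup>2 + X)" for b b'
  proof -
    obtain X where "poly (g b) X = poly (g b') X"
      using inter L(1)[OF g(1)[of b]] L(1)[OF g(1)[of b']] by (auto simp: intersecting_def)
    then have "f b - f b' = - ((b - b') * (X\<^sup>2 + X))" unfolding ev by (simp add: algebra_simps)
    then show ?thesis by (metis neg)
  qed
  have img: "X\<^sup>2 + X = 0 \<or> X\<^sup>2 + X = 1" for X :: 'a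
  proof -
    have "(X\<^sup>2 + X) * (X\<^sup>2 + X) = X ^ 4 + X\<^sup>2 + (X ^ 3 + X ^ 3)"
      by (simp add: algebra_simps power2_eq_square power3_eq_cube power4_eq_xxxx)
    then have "(X\<^sup>2 + X) * (X\<^sup>2 + X) = X\<^sup>2 + X" by (simp add: add2 pow4)
    then show ?thesis by (metis mult_cancel_right1)
  qed
  have slope: "f b - f b' = 0 \<or> f b - f b' = b - b'" for b b'
    using meetg[of b b'] img by (metis mult.right_neutral mult_zero_right)
  define m where "m = f 1 - f 0"
  have m01: "m = 0 \<or> m = 1" using slope[of 1 0] by (simp add: m_def)
  \<comment> \<open>Comparison with \<open>f 0\<close> and \<open>f 1\<close> leaves one value for
    \<open>f b\<close> when b is neither 0 nor 1.\<close>
  have lin: "f b = f 0 + m * b" for b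
  proof (cases "b = 0 \<or> b = 1")
    case False
    define v where "v = f b - f 0"
    have "v = 0 \<or> v = b" using slope[of b 0] by (simp add: v_def)
    moreover have "v - m = 0 \<or> v - m = b - 1" using slope[of b 1] by (simp add: v_def m_def)
    ultimately have "v = m * b" using m01 False by auto
    then show ?thesis by (simp add: v_def algebra_simps)
  qed (auto simp: m_def)
  obtain x1 where x1: "x1\<^sup>2 + x1 + m = 0"
  proof -
    obtain X where "m = X\<^sup>2 + X" using meetg[of 1 0] by (auto simp: m_def)
    then have "X\<^sup>2 + X + m = m + m" by simp
    then show ?thesis using add2 that by metis
  qed
  define x2 where "x2 = x1 + 1"
  have fac: "t\<^sup>2 + t + m = (t - x1) * (t - x2)" for t
  proof -
    have "(t - x1) * (t - x2) = t\<^sup>2 - t - (x1 + x1) * t + (x1\<^sup>2 + x1)"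
      by (simp add: x2_def algebra_simps power2_eq_square)
    also have "x1\<^sup>2 + x1 = m" using x1 neg by (metis add_eq_0_iff2)
    finally show ?thesis by (simp add: add2 sub)
  qed
  have evg: "poly (g b) t = poly (g 0) t + b * ((t - x1) * (t - x2))" for b t
    unfolding ev fac[symmetric] lin[of b] by (simp add: algebra_simps)
  let ?P = "through x1 (poly (g 0) x1)" and ?Q = "through x2 (poly (g 0) x2)"
  \<comment> \<open>If u avoided both points, it would meet the four members \<open>g b\<close> in
    columns other than x1 and x2, where their values are distinct. Four different columns would be
    needed, but only two remain.\<close>
  have "U \<subseteq> ?P \<union> ?Q"
  proof (rule ccontr)
    assume "\<not> ?thesis"
    then obtain u where u: "u \<in> U" "poly u x1 \<noteq> poly (g 0) x1" "poly u x2 \<noteq> poly (g 0) x2"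
      by (auto simp: through_def)
    have "\<forall>b. \<exists>X. poly u X = poly (g b) X"
      using inter u(1) L(1)[OF g(1)] by (auto simp: intersecting_def)
    then obtain X where X: "\<And>b. poly u (X b) = poly (g b) (X b)" by metis
    have Xne: "X b \<noteq> x1" "X b \<noteq> x2" for b
      using X[of b] u(2,3) evg[of b x1] evg[of b x2] by auto
    have "inj X"
    proof (rule injI)
      fix b b' assume "X b = X b'"
      then have "b * ((X b - x1) * (X b - x2)) = b' * ((X b - x1) * (X b - x2))"
        using X[of b] X[of b'] evg[of b "X b"] evg[of b' "X b"] by simp
      then show "b = b'" using Xne[of b] by simp
    qed
    then have "CARD('a) \<le> card (UNIV - {x1, x2})"
      using Xne by (intro card_inj_on_le[of X]) auto
    then show False using q by (simp add: card_Diff_subset x2_def)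
  qed
  moreover have "g ` UNIV \<subseteq> ?P \<inter> ?Q"
    using evg[of _ x1] evg[of _ x2] L(1)[OF g(1)] by (auto simp: through_def)
  moreover have "card (g ` UNIV) = 4" using g(2) q by (subst card_image) (auto intro: injI, metis g(2) injI)
  ultimately have "card U \<le> card (?P \<union> ?Q)" "4 \<le> card (?P \<inter> ?Q)"
    using card_mono[of "?P \<union> ?Q" U] card_mono[of "?P \<inter> ?Q" "g ` UNIV"] by auto
  \<comment> \<open>|P| + |Q| \<ge> 13 + 4, so one of the two has at least 9 members.\<close>
  moreover have "card ?P + card ?Q = card (?P \<union> ?Q) + card (?P \<inter> ?Q)"
    by (rule card_Un_Int) auto
  ultimately have "card ?P \<ge> 9 \<or> card ?Q \<ge> 9" using N13 by linarith
  then show ?thesis using common_point_card4_large[OF two q N13] by blast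
qed

end

section \<open>Orders of finite fields, and the theorem\<close>

lemma finite_field_odd_card:
  assumes "(2::'a::{finite,field}) \<noteq> 0"
  shows "odd CARD('a)"
proof
  assume "even CARD('a)"
  then have "(- 1 :: 'a) = 1" using power_CARD_eq_self[of "- 1 :: 'a"] by simp
  then have "(2::'a) = 0" by (metis add.right_inverse one_add_one)
  with assms show False by blast
qed

text \<open>Comparing (x + 1)^6 = x + 1 with its expansion in characteristic 2 forces x^4 + x^2 = 0,
  so 0 and 1 would be the only elements. This closes the gap between order 4 and the bound 7 of
  \<open>common_point_char2\<close>.\<close>

lemma finite_field_card_ne_6: "CARD('a::{finite,field}) \<noteq> 6"
proof
  assume q: "CARD('a) = 6"
  then have two: "(2::'a) = 0" using finite_field_odd_card[where 'a = 'a] by fastforce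
  have pow6: "a ^ 6 = a" for a :: 'a using power_CARD_eq_self[of a] q by simp
  have "x = 0 \<or> x = 1" for x :: 'a
  proof -
    have "(x + 1) ^ 6 = x ^ 6 + x ^ 4 + x\<^sup>2 + 1 + 2 * (3 * x ^ 5 + 7 * x ^ 4 + 10 * x ^ 3 + 7 * x\<^sup>2 + 3 * x)"
      by algebra
    then have "x\<^sup>2 * (x\<^sup>2 + 1) = 0" by (simp add: pow6 two algebra_simps power2_eq_square power4_eq_xxxx)
    moreover have "x\<^sup>2 + 1 = (x - 1)\<^sup>2 + 2 * x" by (simp add: power2_eq_square algebra_simps)
    ultimately show ?thesis using two by auto
  qed
  then have "(UNIV :: 'a set) \<subseteq> {0, 1}" by auto
  from card_mono[OF _ this] q show False by simp
qed

theorem theorem2: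
  fixes U :: "'a::{finite,field} poly set" and k :: nat
  assumes "if odd (CARD('a)) then CARD('a) > 9 else CARD('a) > 2"
    and "k > 1"
    and "U \<subseteq> polys_deg_le k"
    and "intersecting U"
    and "card U > CARD('a) ^ k - CARD('a) ^ (k - 1)"
  shows "(\<exists>\<alpha> \<beta>. \<forall>g\<in>U. poly g \<alpha> = \<beta>)
     \<and> (\<exists>!W. U \<subseteq> W \<and> W \<subseteq> polys_deg_le k \<and> intersecting W \<and> card W = CARD('a) ^ k)"
proof -
  have base: "\<exists>\<alpha> \<beta>. \<forall>g\<in>V. poly g \<alpha> = \<beta>"
    if V: "V \<subseteq> polys_deg_le 2" "intersecting V" and N: "CARD('a) ^ 2 - CARD('a) < card V"
    for V :: "'a poly set"
  proof -
    interpret intersecting_quadratics V by (rule intersecting_quadratics.intro[OF V])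
    show ?thesis
    proof (cases "(2::'a) = 0")
      case False
      then have odd: "odd CARD('a)" by (rule finite_field_odd_card)
      with assms(1) have "CARD('a) > 9" by simp
      moreover have "CARD('a) \<noteq> 10" using odd by auto
      ultimately show ?thesis by (intro common_point_ge_11 N) simp
    next
      case True
      show ?thesis
      proof (cases "CARD('a) = 4")
        case q4: True
        show ?thesis by (rule common_point_card4[OF True q4 N])
      next
        case False
        \<comment> \<open>An odd order exceeds 9 by assumption; an even one exceeds 2 and is neither
          4 nor 6.\<close>
        have "CARD('a) \<ge> 7"
        proof (cases "odd CARD('a)")
          case even: False
          have "CARD('a) \<noteq> 3" "CARD('a) \<noteq> 5" using even by auto
          then show ?thesis using assms(1) even False finite_field_card_ne_6[where 'a = 'a] by simp
        qed (use assms(1) in simp)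
        then show ?thesis by (rule common_point_char2[OF True N])
      qed
    qed
  qed
  define j where "j = k - 2"
  have k: "k = Suc (Suc j)" using \<open>k > 1\<close> by (simp add: j_def)
  have st: "\<exists>\<alpha> \<beta>. \<forall>g\<in>V. poly g \<alpha> = \<beta>"
    if "V \<subseteq> polys_deg_le (Suc (Suc j))" "intersecting V" "CARD('a) ^ Suc (Suc j) - CARD('a) ^ Suc j < card V"
    for V :: "'a poly set"
    by (rule common_point_from_quadratic[OF base that])
  have U: "U \<subseteq> polys_deg_le (Suc (Suc j))" "card U > CARD('a) ^ Suc (Suc j) - CARD('a) ^ Suc j"
    using assms(3,5) by (simp_all add: k)
  show ?thesis
    unfolding k by (intro conjI st[OF U(1) assms(4) U(2)] unique_extension[OF st U(1) assms(4) U(2)])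
qed

end
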